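(* Let $\mathbb K=\mathbb C$ (holomorphic category) or $\mathbb K=\mathbb R$ (real analytic category). For a normalized triple $(Q,u,v)$ of germs of functions at the origin of $\mathbb K^3$, with associated germ of $4$-web of curves $W(Q,u,v)$ (both as defined in the context), consider the expression $$\frac{2Q_{120}-v_{110}+2v_{020}}{2Q_{201}+u_{101}+v_{101}},$$ where $\phi_{ijk}$ denotes the coefficient of $x^iy^jz^k$ in the Taylor series at the origin of a function $\phi$. As soon as its denominator is non-zero, this expression is an invariant of the isomorphism class of the web $W(Q,u,v)$, and this invariant can be varied at will (that is, it can be given arbitrary values by suitable choices of $(Q,u,v)$).
   Context: Everything is holomorphic, or everything is real analytic; $(x,y,z)$ are the coordinates of $\mathbb K^3$. Given germs of functions $Q,u,v$ at the origin, put $$f=Q'_x-u\,v'_x,\qquad g=Q'_y-u\,v'_y,\qquad h=Q'_z-u\,v'_z$$ (partial derivatives). The web $W(Q,u,v)$ is the $4$-web of curves formed by the four one-dimensional foliations admitting respectively $(f,x)$, $(g,y)$, $(h,z)$, $(u,v)$ as systems of basic functions (i.e. whose leaves are the common level curves of these pairs of functions). A triple $(Q,u,v)$ is called normalized here if $$Q=\frac{x^2}{2}+yz+\cdots,\qquad u=y-x+\cdots,\qquad v=z-x+\cdots,$$ where the dots denote terms of higher order (order $\ge 3$ for $Q$, order $\ge 2$ for $u$ and $v$). For such a triple the four foliations are in general position near the origin (any three of the four tangent directions are linearly independent). Two germs of webs at the origin are isomorphic if there is a germ of biholomorphism (resp. real analytic diffeomorphism) fixing the origin and carrying the first web onto the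 second, i.e. sending the foliations of the first onto the foliations of the second. *)

theory Defs
  imports "HOL-Analysis.Analysis"
begin

text \<open>
  The scalar type \<open>'a\<close> stands for the complex or the real numbers.  A germ of a function at the
  origin is represented by a total function \<open>'a ^ 3 \<Rightarrow> 'a\<close>; its values away from some
  neighbourhood of the origin are irrelevant for everything defined below.

  Analyticity means being locally the sum of a convergent power series; over the complex numbers
  these are the holomorphic functions, over the reals the real analytic ones.
\<close>

definition analytic3_at :: "('a::real_normed_field ^ 3 \<Rightarrow> 'a) \<Rightarrow> 'a ^ 3 \<Rightarrow> bool" where
  "analytic3_at F p \<longleftrightarrow>
     (\<exists>(c :: nat \<times> nat \<times> nat \<Rightarrow> 'a) r. r > 0 \<and>
        (\<forall>w. (\<forall>m. norm (w $ m) < r) \<longrightarrow>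
           ((\<lambda>(i, j, k). c (i, j, k) * (w $ 1) ^ i * (w $ 2) ^ j * (w $ 3) ^ k)
              has_sum F (p + w)) UNIV))"

definition analytic3_map_on :: "('a::real_normed_field ^ 3 \<Rightarrow> 'a ^ 3) \<Rightarrow> ('a ^ 3) set \<Rightarrow> bool" where
  "analytic3_map_on \<phi> U \<longleftrightarrow> (\<forall>p\<in>U. \<forall>m. analytic3_at (\<lambda>q. \<phi> q $ m) p)"

definition partial :: "3 \<Rightarrow> ('a::real_normed_field ^ 3 \<Rightarrow> 'a) \<Rightarrow> 'a ^ 3 \<Rightarrow> 'a" where
  "partial m F p = deriv (\<lambda>t. F (p + axis m t)) 0"

text \<open>Coefficient of \<open>x^i y^j z^k\<close> in the Taylor series at the origin.\<close>

definition taylor :: "('a::real_normed_field ^ 3 \<Rightarrow> 'a) \<Rightarrow> nat \<Rightarrow> nat \<Rightarrow> nat \<Rightarrow> 'a" where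
  "taylor F i j k =
     ((partial 1 ^^ i) ((partial 2 ^^ j) ((partial 3 ^^ k) F))) 0 / (fact i * fact j * fact k)"

definition order_at_least :: "nat \<Rightarrow> ('a::real_normed_field ^ 3 \<Rightarrow> 'a) \<Rightarrow> bool" where
  "order_at_least n F \<longleftrightarrow> (\<forall>i j k. i + j + k < n \<longrightarrow> taylor F i j k = 0)"

definition normalized ::
  "('a::real_normed_field ^ 3 \<Rightarrow> 'a) \<Rightarrow> ('a ^ 3 \<Rightarrow> 'a) \<Rightarrow> ('a ^ 3 \<Rightarrow> 'a) \<Rightarrow> bool" where
  "normalized Q u v \<longleftrightarrow>
     analytic3_at Q 0 \<and> analytic3_at u 0 \<and> analytic3_at v 0 \<and>
     order_at_least 3 (\<lambda>p. Q p - ((p $ 1)\<^sup>2 / 2 + p $ 2 * p $ 3)) \<and>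
     order_at_least 2 (\<lambda>p. u p - (p $ 2 - p $ 1)) \<and>
     order_at_least 2 (\<lambda>p. v p - (p $ 3 - p $ 1))"

text \<open>
  A foliation is given by its leaves: \<open>\<F> U p\<close> is the leaf through \<open>p\<close> of the foliation
  restricted to \<open>U\<close>.  When \<open>(a, b)\<close> is a system of basic functions, the leaves are the connected
  components of the common level sets of \<open>a\<close> and \<open>b\<close>.
\<close>

type_synonym 'a foliation = "('a ^ 3) set \<Rightarrow> 'a ^ 3 \<Rightarrow> ('a ^ 3) set"

definition foliation_of ::
  "('a::real_normed_field ^ 3 \<Rightarrow> 'a) \<Rightarrow> ('a ^ 3 \<Rightarrow> 'a) \<Rightarrow> 'a foliation" where
  "foliation_of a b U p = connected_component_set {q \<in> U. a q = a p \<and> b q = b p} p"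

definition web ::
  "('a::real_normed_field ^ 3 \<Rightarrow> 'a) \<Rightarrow> ('a ^ 3 \<Rightarrow> 'a) \<Rightarrow> ('a ^ 3 \<Rightarrow> 'a) \<Rightarrow> 'a foliation list" where
  "web Q u v =
     (let f = (\<lambda>p. partial 1 Q p - u p * partial 1 v p);
          g = (\<lambda>p. partial 2 Q p - u p * partial 2 v p);
          h = (\<lambda>p. partial 3 Q p - u p * partial 3 v p)
      in [foliation_of f (\<lambda>p. p $ 1),
          foliation_of g (\<lambda>p. p $ 2),
          foliation_of h (\<lambda>p. p $ 3),
          foliation_of u v])"

text \<open>
  Isomorphism of germs of webs at the origin.  Webs are ordered: the \<open>n\<close>-th foliation of the
  first is sent onto the \<open>n\<close>-th foliation of the second.  If the condition holds for \<open>U\<close>, it holds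
  for every smaller open neighbourhood of the origin (with the restricted \<open>\<phi>\<close>), so it only
  concerns germs.
\<close>

definition web_isomorphic ::
  "('a::real_normed_field) foliation list \<Rightarrow> 'a foliation list \<Rightarrow> bool" where
  "web_isomorphic W W' \<longleftrightarrow>
     (\<exists>U V \<phi>. open U \<and> open V \<and> 0 \<in> U \<and> \<phi> 0 = 0 \<and> bij_betw \<phi> U V \<and>
        analytic3_map_on \<phi> U \<and> analytic3_map_on (inv_into U \<phi>) V \<and>
        list_all2 (\<lambda>\<F> \<F>'. \<forall>p\<in>U. \<phi> ` \<F> U p = \<F>' V (\<phi> p)) W W')"

definition inv_numer ::
  "('a::real_normed_field ^ 3 \<Rightarrow> 'a) \<Rightarrow> ('a ^ 3 \<Rightarrow> 'a) \<Rightarrow> ('a ^ 3 \<Rightarrow> 'a) \<Rightarrow> 'a" where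
  "inv_numer Q u v = 2 * taylor Q 1 2 0 - taylor v 1 1 0 + 2 * taylor v 0 2 0"

definition inv_denom ::
  "('a::real_normed_field ^ 3 \<Rightarrow> 'a) \<Rightarrow> ('a ^ 3 \<Rightarrow> 'a) \<Rightarrow> ('a ^ 3 \<Rightarrow> 'a) \<Rightarrow> 'a" where
  "inv_denom Q u v = 2 * taylor Q 2 0 1 + taylor u 1 0 1 + taylor v 1 0 1"

end

theory Submission
  imports Defs
begin

text \<open>
  The denominator and the numerator are two entries of the torsion of the web.  If \<open>X\<^sub>i\<close> is a
  vector field tangent to the \<open>i\<close>-th foliation with a prescribed value at the origin, the bracket
  \<open>[X\<^sub>i, X\<^sub>j](0)\<close> modulo \<open>X\<^sub>i(0)\<close> and \<open>X\<^sub>j(0)\<close> depends only on the foliations; it is the obstruction to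
  integrating the planes spanned by \<open>X\<^sub>i\<close> and \<open>X\<^sub>j\<close>.  For a normalized triple the tangent directions
  at the origin are the third, first and second axis and \<open>(1, 1, 1)\<close>, and the brackets for the pairs
  \<open>(1, 2)\<close> and \<open>(2, 3)\<close> are, up to sign, the mixed derivatives \<open>f\<^sub>x\<^sub>z(0)\<close> and \<open>g\<^sub>x\<^sub>y(0)\<close>
  (\<open>inv_denom_eq\<close>, \<open>inv_numer_eq\<close>).  An isomorphism preserves four directions in general position,
  so its derivative at the origin is a scalar \<open>\<mu>\<close>.  A bracket picks up \<open>\<mu>\<^sup>2\<close> from the two fields and
  \<open>\<mu>\<close> from the push-forward, so every torsion entry is divided by \<open>\<mu>\<close>, and quotients of torsion
  entries are unchanged (\<open>torsion_scaling\<close>).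

  The formal argument uses functions in place of vector fields.  The isomorphism \<open>\<phi>\<close> pulls the basic
  functions of a target foliation back to functions \<open>\<Psi>\<close> that are constant on the leaves of the source
  foliation.  The inverse function theorem provides a curve in the leaf through each point near the
  origin, so the differential of \<open>\<Psi>\<close> vanishes on the tangent line there (\<open>leaf_tangent\<close>).  For
  the foliation with basic functions \<open>a = x\<^sub>n + \<dots>\<close> and \<open>x\<^sub>i\<close>, directed along the \<open>d\<close>-th axis at the
  origin, this is the identity \<open>\<Psi>\<^sub>d a\<^sub>n = \<Psi>\<^sub>n a\<^sub>d\<close>.  Its value and its first derivatives at the origin
  (\<open>first_integral_jet\<close>), applied to \<open>\<Psi> = \<phi>\<^sub>i\<close> and \<open>\<Psi> = a' \<circ> \<phi>\<close> and expanded by the chain rule, show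
  that the derivative of \<open>\<phi>\<close> is \<open>\<mu>\<close> and how the torsion scales.  The real and the complex case are
  treated at once, over a normed field that is a Euclidean space.

  Every value of the quotient occurs already for linear \<open>u\<close>, \<open>v\<close> and a cubic \<open>Q\<close>
  (\<open>invariant_attained\<close>).
\<close>

section \<open>Termwise differentiation of power series in three variables\<close>

text \<open>
  The derivative is the real Frechet derivative, to which the inverse function theorem applies;
  that it is given by a gradient with entries in \<open>'a\<close> makes it linear over \<open>'a\<close>.
\<close>

definition has_grad :: "('a::real_normed_field ^ 3 \<Rightarrow> 'a) \<Rightarrow> 'a ^ 3 \<Rightarrow> 'a ^ 3 \<Rightarrow> bool" where
  "has_grad F D p \<longleftrightarrow> (F has_derivative (\<lambda>w. \<Sum>m\<in>UNIV. D $ m * w $ m)) (at p)"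

definition mterm :: "(nat \<times> nat \<times> nat \<Rightarrow> 'a::real_normed_field) \<Rightarrow> 'a ^ 3 \<Rightarrow> nat \<times> nat \<times> nat \<Rightarrow> 'a" where
  "mterm c w = (\<lambda>(i, j, k). c (i, j, k) * (w $ 1) ^ i * (w $ 2) ^ j * (w $ 3) ^ k)"

definition dmterm ::
  "3 \<Rightarrow> (nat \<times> nat \<times> nat \<Rightarrow> 'a::real_normed_field) \<Rightarrow> 'a ^ 3 \<Rightarrow> nat \<times> nat \<times> nat \<Rightarrow> 'a" where
  "dmterm m c w = (\<lambda>(i, j, k).
     if m = 1 then c (i, j, k) * (of_nat i * (w $ 1) ^ (i - 1)) * (w $ 2) ^ j * (w $ 3) ^ k
     else if m = 2 then c (i, j, k) * (w $ 1) ^ i * (of_nat j * (w $ 2) ^ (j - 1)) * (w $ 3) ^ k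
     else c (i, j, k) * (w $ 1) ^ i * (w $ 2) ^ j * (of_nat k * (w $ 3) ^ (k - 1)))"

fun dcoeff ::
  "3 \<Rightarrow> (nat \<times> nat \<times> nat \<Rightarrow> 'a::real_normed_field) \<Rightarrow> nat \<times> nat \<times> nat \<Rightarrow> 'a" where
  "dcoeff m c (i, j, k) =
     (if m = 1 then of_nat (Suc i) * c (Suc i, j, k)
      else if m = 2 then of_nat (Suc j) * c (i, Suc j, k)
      else of_nat (Suc k) * c (i, j, Suc k))"

lemma dcoeff_commute: "dcoeff m (dcoeff n c) = dcoeff n (dcoeff m c)"
  by (rule ext) (auto simp: algebra_simps)

text \<open>
  Unconditional summability is absolute for real families, and a finite-dimensional family is
  controlled by its coordinates.
\<close>

lemma abs_summable_on_euclidean: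
  fixes f :: "'b \<Rightarrow> 'a::euclidean_space"
  assumes "f summable_on A"
  shows "(\<lambda>x. norm (f x)) summable_on A"
proof -
  have "(\<lambda>x. \<bar>f x \<bullet> b\<bar>) summable_on A" for b
    using summable_on_bounded_linear[OF bounded_linear_inner_left assms, of b]
      summable_on_iff_abs_summable_on_real[of "\<lambda>x. f x \<bullet> b" A]
    by (simp add: o_def)
  then have "(\<lambda>x. \<Sum>b\<in>Basis. \<bar>f x \<bullet> b\<bar>) summable_on A"
  proof -
    have "(\<lambda>x. \<Sum>b\<in>B. \<bar>f x \<bullet> b\<bar>) summable_on A" if "finite B" for B
      using that \<open>\<And>b. (\<lambda>x. \<bar>f x \<bullet> b\<bar>) summable_on A\<close>
      by (induction B rule: finite_induct) (auto intro: summable_on_add)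
    then show ?thesis by simp
  qed
  then show ?thesis
    by (rule summable_on_comparison_test) (auto intro: norm_le_l1)
qed

lemma mterm_has_grad: "has_grad (\<lambda>w. mterm c w \<alpha>) (\<chi> m. dmterm m c w \<alpha>) w"
proof -
  obtain i j k where a: "\<alpha> = (i, j, k)" by (cases \<alpha>)
  show ?thesis
    unfolding has_grad_def mterm_def dmterm_def a
    by (auto intro!: derivative_eq_intros bounded_linear.has_derivative[OF bounded_linear_vec_nth]
        simp: sum_3 algebra_simps fun_eq_iff)
qed

lemma norm_dmterm_le:
  assumes "\<And>m. norm (w $ m) \<le> \<rho>" and "\<rho> > 0"
  shows "norm (dmterm m c w (i, j, k)) \<le> norm (c (i, j, k)) * (real (i + j + k) * \<rho> ^ (i + j + k - 1))"
proof -
  have gen: "A * (real a * x ^ (a - 1)) * y ^ b * z ^ d \<le> A * (real n * \<rho> ^ (n - 1))"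
    if "n = a + b + d" "x \<ge> 0" "y \<ge> 0" "z \<ge> 0" "x \<le> \<rho>" "y \<le> \<rho>" "z \<le> \<rho>" "A \<ge> 0"
    for A x y z :: real and a b d n
  proof (cases a)
    case 0
    then show ?thesis using that assms by simp
  next
    case (Suc a')
    have "x ^ a' * y ^ b * z ^ d \<le> \<rho> ^ a' * \<rho> ^ b * \<rho> ^ d"
      using that assms by (intro mult_mono power_mono mult_nonneg_nonneg) auto
    also have "\<dots> = \<rho> ^ (n - 1)"
      using that Suc by (simp add: power_add)
    finally have 1: "x ^ a' * y ^ b * z ^ d \<le> \<rho> ^ (n - 1)" .
    have "real a * (x ^ a' * y ^ b * z ^ d) \<le> real n * \<rho> ^ (n - 1)"
      using that 1 by (intro mult_mono) auto
    then show ?thesis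
      using \<open>A \<ge> 0\<close> Suc by (simp add: mult.assoc mult_left_mono)
  qed
  show ?thesis
    unfolding dmterm_def
    using gen[of "i+j+k" i j k "norm (w$1)" "norm (w$2)" "norm (w$3)" "norm (c (i, j, k))"]
      gen[of "i+j+k" j i k "norm (w$2)" "norm (w$1)" "norm (w$3)" "norm (c (i, j, k))"]
      gen[of "i+j+k" k i j "norm (w$3)" "norm (w$1)" "norm (w$2)" "norm (c (i, j, k))"]
      assms
    by (simp add: norm_mult norm_power mult_ac)
qed

text \<open>
  The differentiated terms are dominated uniformly on a closed polydisc: absolute convergence on a
  slightly larger one leaves a geometric factor, which absorbs the degree coming from differentiation.
\<close>

lemma power_series_majorant:
  fixes F :: "'a::{real_normed_field,euclidean_space} ^ 3 \<Rightarrow> 'a"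
  assumes ps: "\<And>w. (\<forall>m. norm (w $ m) < r) \<Longrightarrow> (mterm c w has_sum F (p + w)) UNIV"
    and \<rho>: "0 < \<rho>" "\<rho> < r"
  obtains M where "M summable_on UNIV"
    and "\<And>m w \<alpha>. (\<forall>n. norm (w $ n) \<le> \<rho>) \<Longrightarrow> norm (dmterm m c w \<alpha>) \<le> M \<alpha>"
proof -
  obtain s where s: "\<rho> < s" "s < r" using \<rho> dense by blast
  have "mterm c (\<chi> m. of_real s) summable_on UNIV"
    using ps[of "\<chi> m. of_real s"] s \<rho> by (auto simp: summable_on_def)
  from abs_summable_on_euclidean[OF this]
  have sum: "(\<lambda>(i, j, k). norm (c (i, j, k)) * s ^ (i + j + k)) summable_on UNIV"
    using s \<rho> by (simp add: mterm_def norm_mult norm_power case_prod_unfold power_add mult.assoc)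
  have "(\<lambda>n. real n * (\<rho> / s) ^ n) \<longlonglongrightarrow> 0"
    using s \<rho> by (intro powser_times_n_limit_0) auto
  then have "Bseq (\<lambda>n. real n * (\<rho> / s) ^ n)"
    by (intro convergent_imp_Bseq) (auto simp: convergent_def)
  then obtain B where B: "\<And>n. norm (real n * (\<rho> / s) ^ n) \<le> B"
    unfolding Bseq_def by blast
  have K: "real n * \<rho> ^ (n - 1) \<le> B / \<rho> * s ^ n" for n
  proof (cases n)
    case 0
    then show ?thesis using B[of 0] \<rho> by simp
  next
    case (Suc n')
    have "real n * (\<rho> / s) ^ n \<le> B" using B[of n] by simp
    then show ?thesis
      using s \<rho> Suc by (simp add: field_simps power_divide)
  qed
  show ?thesis
  proof
    show "(\<lambda>\<alpha>. B / \<rho> * (case \<alpha> of (i, j, k) \<Rightarrow> norm (c (i, j, k)) * s ^ (i + j + k))) summable_on UNIV"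
      using sum by (rule summable_on_cmult_right)
    fix m :: 3 and w :: "'a ^ 3" and \<alpha> :: "nat \<times> nat \<times> nat"
    assume w: "\<forall>n. norm (w $ n) \<le> \<rho>"
    obtain i j k where a: "\<alpha> = (i, j, k)" by (cases \<alpha>)
    have "norm (dmterm m c w \<alpha>) \<le> norm (c (i, j, k)) * (real (i + j + k) * \<rho> ^ (i + j + k - 1))"
      unfolding a using w \<rho> by (intro norm_dmterm_le) auto
    also have "\<dots> \<le> norm (c (i, j, k)) * (B / \<rho> * s ^ (i + j + k))"
      by (intro mult_left_mono K) auto
    finally show "norm (dmterm m c w \<alpha>) \<le> B / \<rho> * (case \<alpha> of (i, j, k) \<Rightarrow> norm (c (i, j, k)) * s ^ (i + j + k))"
      by (simp add: a mult_ac)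
  qed
qed

lemma open_polydisc: "open {x::'a::real_normed_vector ^ 3. \<forall>m. norm (x $ m) < r}"
proof -
  have "{x::'a ^ 3. \<forall>m. norm (x $ m) < r} = (\<Inter>m. {x. norm (x $ m) < r})" by auto
  moreover have "open {x::'a ^ 3. norm (x $ m) < r}" for m
    by (intro open_Collect_less continuous_intros)
  ultimately show ?thesis by auto
qed

lemma convex_polydisc: "convex {x::'a::real_normed_vector ^ 3. \<forall>m. norm (x $ m) < r}"
proof -
  have "{x::'a ^ 3. \<forall>m. norm (x $ m) < r} = (\<Inter>m. (\<lambda>x. x $ m) -` ball 0 r)" by auto
  moreover have "convex ((\<lambda>x::'a ^ 3. x $ m) -` ball 0 r)" for m
    by (intro convex_linear_vimage convex_ball) (simp add: bounded_linear.linear[OF bounded_linear_vec_nth])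
  ultimately show ?thesis by (auto intro: convex_INT)
qed

text \<open>
  With the summable majorant the partial sums of each partial derivative converge uniformly on a
  smaller polydisc, so the series may be differentiated term by term.  Enumerating the index set
  reduces this to the theorem on sequences of partial sums.
\<close>

lemma power_series_has_grad:
  fixes F :: "'a::{real_normed_field,euclidean_space} ^ 3 \<Rightarrow> 'a"
  assumes ps: "\<And>w. (\<forall>m. norm (w $ m) < r) \<Longrightarrow> (mterm c w has_sum F (p + w)) UNIV"
    and w: "\<forall>m. norm (w $ m) < r"
  shows "has_grad F (\<chi> m. \<Sum>\<^sub>\<infinity>\<alpha>. dmterm m c w \<alpha>) (p + w)"
    and "dmterm m c w summable_on UNIV"
proof -
  obtain \<rho> where \<rho>: "\<forall>m. norm (w $ m) < \<rho>" "\<rho> < r"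
  proof -
    define M where "M = Max (range (\<lambda>m. norm (w $ m)))"
    have "M \<in> range (\<lambda>m. norm (w $ m))" unfolding M_def by (intro Max_in) auto
    then have "M < r" using w by auto
    moreover have "norm (w $ m) \<le> M" for m unfolding M_def by (intro Max_ge) auto
    ultimately show ?thesis using that dense[of M r] by (meson le_less_trans)
  qed
  have \<rho>0: "0 < \<rho>" using \<rho>(1) norm_ge_zero le_less_trans by blast
  obtain M where M: "M summable_on UNIV"
    and leM: "\<And>m w \<alpha>. (\<forall>n. norm (w $ n) \<le> \<rho>) \<Longrightarrow> norm (dmterm m c w \<alpha>) \<le> M \<alpha>"
    using power_series_majorant[OF ps \<rho>0 \<rho>(2)] by blast
  define e where "e = from_nat_into (UNIV :: (nat \<times> nat \<times> nat) set)"
  have inf: "infinite (UNIV :: (nat \<times> nat \<times> nat) set)"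
    by (simp add: finite_prod)
  have e: "bij_betw e UNIV UNIV"
    unfolding e_def using inf by (intro bij_betw_from_nat_into) auto
  define S where "S = {x::'a ^ 3. \<forall>m. norm (x $ m) < \<rho>}"
  have wS: "w \<in> S" using \<rho> by (simp add: S_def)
  have sumsF: "(\<lambda>n. mterm c x (e n)) sums F (p + x)" if "x \<in> S" for x
  proof -
    have "(mterm c x has_sum F (p + x)) UNIV"
      using that \<rho>(2) by (intro ps) (auto simp: S_def intro: less_trans)
    then have "((\<lambda>n. mterm c x (e n)) has_sum F (p + x)) UNIV"
      by (subst has_sum_reindex_bij_betw[OF e])
    then show ?thesis by (rule has_sum_imp_sums)
  qed
  have abs: "dmterm m c x summable_on UNIV" if "x \<in> S" for m x
  proof (rule abs_summable_summable)
    show "(\<lambda>\<alpha>. norm (dmterm m c x \<alpha>)) summable_on UNIV"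
      using that by (intro summable_on_comparison_test[OF M] leM) (auto simp: S_def less_imp_le)
  qed
  show "dmterm m c w summable_on UNIV" using abs[OF wS] .
  have suminf: "(\<lambda>n. dmterm m c x (e n)) sums (\<Sum>\<^sub>\<infinity>\<alpha>. dmterm m c x \<alpha>)" if "x \<in> S" for m x
    using has_sum_infsum[OF abs[OF that, of m]]
    by (intro has_sum_imp_sums) (subst has_sum_reindex_bij_betw[OF e])
  have "summable (\<lambda>n. M (e n))"
    using M by (subst (asm) summable_on_reindex_bij_betw[OF e, symmetric])
      (rule summable_on_imp_summable)
  then have "uniform_limit S (\<lambda>n x. \<Sum>i<n. dmterm m c x (e i)) (\<lambda>x. \<Sum>i. dmterm m c x (e i)) sequentially" for m
    by (intro Weierstrass_m_test[where M = "\<lambda>n. M (e n)"] leM) (auto simp: S_def less_imp_le)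
  then have ul: "uniform_limit S (\<lambda>n x. \<Sum>i<n. dmterm m c x (e i)) (\<lambda>x. \<Sum>\<^sub>\<infinity>\<alpha>. dmterm m c x \<alpha>) sequentially" for m
    by (rule uniform_limit_cong'[THEN iffD1, rotated -1]) (auto simp: sums_unique[OF suminf])
  have "\<exists>g. \<forall>x\<in>S. (\<lambda>n. mterm c x (e n)) sums (g x) \<and>
     (g has_derivative (\<lambda>h. \<Sum>m\<in>UNIV. (\<Sum>\<^sub>\<infinity>\<alpha>. dmterm m c x \<alpha>) * h $ m)) (at x within S)"
  proof (rule has_derivative_series)
    show "convex S" unfolding S_def by (rule convex_polydisc)
    show "((\<lambda>x. mterm c x (e n)) has_derivative (\<lambda>h. \<Sum>m\<in>UNIV. dmterm m c x (e n) * h $ m)) (at x within S)" for n x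
      using mterm_has_grad[of c "e n" x] by (auto simp: has_grad_def intro: has_derivative_at_withinI)
    show "w \<in> S" by fact
    show "(\<lambda>n. mterm c w (e n)) sums F (p + w)" using sumsF[OF wS] .
    fix \<epsilon> :: real assume "\<epsilon> > 0"
    then have "\<forall>\<^sub>F n in sequentially. \<forall>x\<in>S. dist (\<Sum>i<n. dmterm m c x (e i)) (\<Sum>\<^sub>\<infinity>\<alpha>. dmterm m c x \<alpha>) < \<epsilon> / 3" for m
      by (intro uniform_limitD[OF ul]) simp
    then have "\<forall>\<^sub>F n in sequentially. \<forall>m. \<forall>x\<in>S. dist (\<Sum>i<n. dmterm m c x (e i)) (\<Sum>\<^sub>\<infinity>\<alpha>. dmterm m c x \<alpha>) < \<epsilon> / 3"
      by (simp add: eventually_all_finite)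
    then show "\<forall>\<^sub>F n in sequentially. \<forall>x\<in>S. \<forall>h. norm ((\<Sum>i<n. \<Sum>m\<in>UNIV. dmterm m c x (e i) * h $ m)
        - (\<Sum>m\<in>UNIV. (\<Sum>\<^sub>\<infinity>\<alpha>. dmterm m c x \<alpha>) * h $ m)) \<le> \<epsilon> * norm h"
    proof eventually_elim
      case (elim n)
      show ?case
      proof (intro ballI allI)
        fix x h assume "x \<in> S"
        have "(\<Sum>i<n. \<Sum>m\<in>UNIV. dmterm m c x (e i) * h $ m) - (\<Sum>m\<in>UNIV. (\<Sum>\<^sub>\<infinity>\<alpha>. dmterm m c x \<alpha>) * h $ m)
          = (\<Sum>m\<in>UNIV. ((\<Sum>i<n. dmterm m c x (e i)) - (\<Sum>\<^sub>\<infinity>\<alpha>. dmterm m c x \<alpha>)) * h $ m)"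
          by (subst sum.swap) (simp add: sum_distrib_right sum_subtractf left_diff_distrib)
        also have "norm \<dots> \<le> (\<Sum>m\<in>(UNIV::3 set). \<epsilon> / 3 * norm h)"
        proof (rule order_trans[OF norm_sum sum_mono])
          fix m :: 3
          have "norm ((\<Sum>i<n. dmterm m c x (e i)) - (\<Sum>\<^sub>\<infinity>\<alpha>. dmterm m c x \<alpha>)) \<le> \<epsilon> / 3"
            using elim \<open>x \<in> S\<close> by (auto simp: dist_norm less_imp_le)
          then show "norm (((\<Sum>i<n. dmterm m c x (e i)) - (\<Sum>\<^sub>\<infinity>\<alpha>. dmterm m c x \<alpha>)) * h $ m) \<le> \<epsilon> / 3 * norm h"
            unfolding norm_mult using Finite_Cartesian_Product.norm_nth_le[of h m] \<open>\<epsilon> > 0\<close>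
            by (intro mult_mono) auto
        qed
        finally show "norm ((\<Sum>i<n. \<Sum>m\<in>UNIV. dmterm m c x (e i) * h $ m)
            - (\<Sum>m\<in>UNIV. (\<Sum>\<^sub>\<infinity>\<alpha>. dmterm m c x \<alpha>) * h $ m)) \<le> \<epsilon> * norm h"
          by simp
      qed
    qed
  qed
  then obtain g where g: "\<And>x. x \<in> S \<Longrightarrow> (\<lambda>n. mterm c x (e n)) sums (g x)"
    and g': "\<And>x. x \<in> S \<Longrightarrow> (g has_derivative (\<lambda>h. \<Sum>m\<in>UNIV. (\<Sum>\<^sub>\<infinity>\<alpha>. dmterm m c x \<alpha>) * h $ m)) (at x within S)"
    by blast
  have "open S" unfolding S_def by (rule open_polydisc)
  have "(g has_derivative (\<lambda>h. \<Sum>m\<in>UNIV. (\<Sum>\<^sub>\<infinity>\<alpha>. dmterm m c w \<alpha>) * h $ m)) (at w)"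
    using g'[OF wS] at_within_open[OF wS \<open>open S\<close>] by simp
  then have "((\<lambda>x. F (p + x)) has_derivative (\<lambda>h. \<Sum>m\<in>UNIV. (\<Sum>\<^sub>\<infinity>\<alpha>. dmterm m c w \<alpha>) * h $ m)) (at w)"
    by (rule has_derivative_transform_within_open[OF _ \<open>open S\<close> wS])
      (use g sumsF sums_unique2 in blast)
  moreover have "((\<lambda>x. x - p) has_derivative (\<lambda>h. h)) (at (p + w))"
    by (auto intro!: derivative_eq_intros)
  ultimately have "((\<lambda>x. F (p + (x - p))) has_derivative (\<lambda>h. \<Sum>m\<in>UNIV. (\<Sum>\<^sub>\<infinity>\<alpha>. dmterm m c w \<alpha>) * h $ m)) (at (p + w))"
    using has_derivative_compose[of "\<lambda>x. x - p" "\<lambda>h. h" "p + w" UNIV "\<lambda>x. F (p + x)"] by simp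
  then show "has_grad F (\<chi> m. \<Sum>\<^sub>\<infinity>\<alpha>. dmterm m c w \<alpha>) (p + w)"
    by (simp add: has_grad_def)
qed

section \<open>Gradients and partial derivatives\<close>

definition grad :: "('a::real_normed_field ^ 3 \<Rightarrow> 'a) \<Rightarrow> 'a ^ 3 \<Rightarrow> 'a ^ 3" where
  "grad F p = (\<chi> m. partial m F p)"

lemma grad_nth [simp]: "grad F p $ m = partial m F p"
  by (simp add: grad_def)

text \<open>
  Holomorphic or real differentiability at a point, with the gradient identified with the vector of
  partial derivatives so that the two calculi can be exchanged freely.
\<close>

definition kdiff :: "('a::real_normed_field ^ 3 \<Rightarrow> 'a) \<Rightarrow> 'a ^ 3 \<Rightarrow> bool" where
  "kdiff F p \<longleftrightarrow> has_grad F (grad F p) p"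

lemma bounded_linear_axis: "bounded_linear (axis m :: 'a::real_normed_field \<Rightarrow> 'a ^ 3)"
proof (rule bounded_linear_intro[where K = 1])
  fix x :: 'a
  have "(norm (axis m x $ i))\<^sup>2 = (if i = m then (norm x)\<^sup>2 else 0)" for i :: 3
    by (simp add: axis_def)
  then show "norm (axis m x :: 'a ^ 3) \<le> norm x * 1"
    by (simp add: norm_vec_def L2_set_def)
qed (auto simp: axis_def vec_eq_iff)

lemma axis_zero [simp]: "axis m 0 = 0"
  by (simp add: vec_eq_iff axis_def)

lemma partial_eq:
  assumes "has_grad F D p"
  shows "partial m F p = D $ m"
proof -
  have "((\<lambda>t. p + axis m t) has_derivative (\<lambda>t. 0 + axis m t)) (at 0)"
    by (intro has_derivative_add has_derivative_const bounded_linear_imp_has_derivative bounded_linear_axis)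
  moreover have "(F has_derivative (\<lambda>w. \<Sum>m\<in>UNIV. D $ m * w $ m)) (at (p + axis m 0))"
    using assms by (simp add: has_grad_def)
  ultimately have "((\<lambda>t. F (p + axis m t)) has_derivative (\<lambda>t. \<Sum>n\<in>UNIV. D $ n * (0 + axis m t) $ n)) (at 0)"
    by (rule has_derivative_compose)
  moreover have "(\<lambda>t. \<Sum>n\<in>UNIV. D $ n * (0 + axis m t) $ n) = (*) (D $ m)"
    by (auto simp: axis_def if_distrib cong: if_cong)
  ultimately have "((\<lambda>t. F (p + axis m t)) has_field_derivative D $ m) (at 0)"
    by (simp add: has_field_derivative_def)
  then show ?thesis by (simp add: partial_def DERIV_imp_deriv)
qed

lemma has_grad_imp_kdiff: "has_grad F D p \<Longrightarrow> kdiff F p"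
proof -
  assume "has_grad F D p"
  moreover from this have "grad F p = D" by (simp add: vec_eq_iff partial_eq)
  ultimately show ?thesis by (simp add: kdiff_def)
qed

lemma has_grad_cong:
  assumes "\<forall>\<^sub>F q in nhds p. F q = G q"
  shows "has_grad F D p \<longleftrightarrow> has_grad G D p"
proof -
  have 1: "eventually (\<lambda>q. F q = G q) (at p)" "F p = G p"
    using assms eventually_nhds_x_imp_x[OF assms] by (simp_all add: eventually_nhds_conv_at)
  then have 2: "eventually (\<lambda>q. G q = F q) (at p)"
    by (simp add: eq_commute)
  show ?thesis unfolding has_grad_def
    using has_derivative_transform_eventually[OF _ 1(1) 1(2)]
      has_derivative_transform_eventually[OF _ 2 1(2)[symmetric]] by blast
qed

lemma partial_cong:
  assumes "\<forall>\<^sub>F q in nhds p. F q = G q"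
  shows "partial m F p = partial m G p"
proof -
  have "F p = G p" using eventually_nhds_x_imp_x[OF assms] .
  have "isCont (\<lambda>t. p + axis m t) 0"
    by (intro isCont_add continuous_const bounded_linear.isCont[OF bounded_linear_axis] continuous_ident)
  then have "filterlim (\<lambda>t. p + axis m t) (nhds (p + axis m 0)) (nhds 0)"
    unfolding isCont_def by (rule tendsto_at_iff_tendsto_nhds[THEN iffD1])
  then have "\<forall>\<^sub>F t in nhds 0. F (p + axis m t) = G (p + axis m t)"
    using eventually_compose_filterlim[OF assms, of "\<lambda>t. p + axis m t" "nhds 0"] by simp
  then show ?thesis unfolding partial_def by (intro deriv_cong_ev) auto
qed

lemma kdiff_cong:
  assumes "\<forall>\<^sub>F q in nhds p. F q = G q"
  shows "kdiff F p \<longleftrightarrow> kdiff G p"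
  unfolding kdiff_def grad_def by (simp add: has_grad_cong[OF assms] partial_cong[OF assms])

lemma kdiff_isCont: "kdiff F p \<Longrightarrow> isCont F p"
  unfolding kdiff_def has_grad_def by (rule has_derivative_continuous)

lemma has_grad_diff: "has_grad F D p \<Longrightarrow> has_grad G E p \<Longrightarrow> has_grad (\<lambda>q. F q - G q) (D - E) p"
  unfolding has_grad_def by (auto intro!: derivative_eq_intros simp: sum_3 algebra_simps)

lemma has_grad_add: "has_grad F D p \<Longrightarrow> has_grad G E p \<Longrightarrow> has_grad (\<lambda>q. F q + G q) (D + E) p"
  unfolding has_grad_def by (auto intro!: derivative_eq_intros simp: sum_3 algebra_simps)

lemma has_grad_mult:
  "has_grad F D p \<Longrightarrow> has_grad G E p \<Longrightarrow> has_grad (\<lambda>q. F q * G q) (F p *s E + G p *s D) p"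
  unfolding has_grad_def by (auto intro!: derivative_eq_intros simp: sum_3 algebra_simps)

lemma has_grad_const: "has_grad (\<lambda>q. c) 0 p"
  unfolding has_grad_def by (auto intro!: derivative_eq_intros)

lemma has_grad_coord: "has_grad (\<lambda>q. q $ k) (axis k 1) p"
  unfolding has_grad_def
  by (auto intro!: derivative_eq_intros bounded_linear.has_derivative[OF bounded_linear_vec_nth]
      simp: axis_def if_distrib if_distribR cong: if_cong)

lemma has_derivative_components:
  fixes \<phi> :: "'b::real_normed_vector \<Rightarrow> 'a::euclidean_space ^ 'n"
  assumes "\<And>k. ((\<lambda>q. \<phi> q $ k) has_derivative (\<lambda>w. L w $ k)) (at p)"
  shows "(\<phi> has_derivative L) (at p)"
proof (subst has_derivative_componentwise_within, intro ballI)
  fix b :: "'a ^ 'n" assume "b \<in> Basis"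
  then obtain k c where b: "b = axis k c" by (auto simp: Basis_vec_def)
  have "((\<lambda>q. \<phi> q $ k \<bullet> c) has_derivative (\<lambda>w. L w $ k \<bullet> c)) (at p)"
    using assms by (rule has_derivative_inner_left)
  then show "((\<lambda>q. \<phi> q \<bullet> b) has_derivative (\<lambda>w. L w \<bullet> b)) (at p)"
    by (simp add: b inner_axis)
qed

lemma has_grad_compose:
  fixes \<phi> :: "'a::{real_normed_field,euclidean_space} ^ 3 \<Rightarrow> 'a ^ 3"
  assumes "has_grad G D (\<phi> p)" and "\<And>k. has_grad (\<lambda>q. \<phi> q $ k) (E k) p"
  shows "has_grad (\<lambda>q. G (\<phi> q)) (\<chi> m. \<Sum>k\<in>UNIV. D $ k * E k $ m) p"
proof -
  have "(\<phi> has_derivative (\<lambda>w. \<chi> k. \<Sum>m\<in>UNIV. E k $ m * w $ m)) (at p)"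
    using assms(2) by (intro has_derivative_components) (simp add: has_grad_def)
  from has_derivative_compose[OF this assms(1)[unfolded has_grad_def]] show ?thesis
    unfolding has_grad_def by (simp add: sum_3 algebra_simps)
qed

section \<open>Partial derivatives of analytic functions\<close>

lemma analytic3_at_iff:
  "analytic3_at F p \<longleftrightarrow> (\<exists>c r. r > 0 \<and> (\<forall>w. (\<forall>m. norm (w $ m) < r) \<longrightarrow> (mterm c w has_sum F (p + w)) UNIV))"
  unfolding analytic3_at_def mterm_def ..

text \<open>
  Lowering one exponent is a shift of the index set; the terms outside the range of the shift do not
  involve the variable and differentiate to zero.
\<close>

lemma dmterm_has_sum:
  "(dmterm m c w has_sum s) UNIV \<longleftrightarrow> (mterm (dcoeff m c) w has_sum s) UNIV"
proof -
  define h :: "nat \<times> nat \<times> nat \<Rightarrow> nat \<times> nat \<times> nat" where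
    "h = (\<lambda>(i, j, k). if m = 1 then (Suc i, j, k) else if m = 2 then (i, Suc j, k) else (i, j, Suc k))"
  have inj: "inj h" by (auto simp: h_def inj_def)
  have "(dmterm m c w has_sum s) UNIV \<longleftrightarrow> (dmterm m c w has_sum s) (range h)"
  proof (rule has_sum_cong_neutral)
    fix x assume x: "x \<in> UNIV - range h"
    obtain i j k where ijk: "x = (i, j, k)" by (cases x)
    have "x \<noteq> h (i - 1, j, k)" "x \<noteq> h (i, j - 1, k)" "x \<noteq> h (i, j, k - 1)"
      using x by auto
    then have "m = 1 \<Longrightarrow> i = 0" "m = 2 \<Longrightarrow> j = 0" "m \<noteq> 1 \<Longrightarrow> m \<noteq> 2 \<Longrightarrow> k = 0"
      by (auto simp: h_def ijk split: if_splits)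
    then show "dmterm m c w x = 0"
      by (auto simp: dmterm_def ijk)
  qed auto
  also have "\<dots> \<longleftrightarrow> ((dmterm m c w \<circ> h) has_sum s) UNIV"
    by (rule has_sum_reindex[OF inj])
  also have "dmterm m c w \<circ> h = mterm (dcoeff m c) w"
    by (auto simp: fun_eq_iff dmterm_def mterm_def h_def)
  finally show ?thesis .
qed

lemma power_series_partial:
  fixes F :: "'a::{real_normed_field,euclidean_space} ^ 3 \<Rightarrow> 'a"
  assumes ps: "\<And>w. (\<forall>m. norm (w $ m) < r) \<Longrightarrow> (mterm c w has_sum F (p + w)) UNIV"
    and w: "\<forall>m. norm (w $ m) < r"
  shows "(mterm (dcoeff m c) w has_sum partial m F (p + w)) UNIV"
proof -
  have "(dmterm m c w has_sum (\<Sum>\<^sub>\<infinity>\<alpha>. dmterm m c w \<alpha>)) UNIV"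
    using power_series_has_grad(2)[OF ps w] by simp
  moreover have "(\<Sum>\<^sub>\<infinity>\<alpha>. dmterm m c w \<alpha>) = partial m F (p + w)"
    using partial_eq[OF power_series_has_grad(1)[OF ps w], of m] by simp
  ultimately show ?thesis by (simp add: dmterm_has_sum)
qed

lemma analytic3_partial:
  fixes F :: "'a::{real_normed_field,euclidean_space} ^ 3 \<Rightarrow> 'a"
  assumes "analytic3_at F p"
  shows "analytic3_at (partial m F) p"
  using assms power_series_partial unfolding analytic3_at_iff by metis

lemma eventually_polydisc:
  fixes p :: "'a::real_normed_vector ^ 3"
  assumes "r > 0" and "\<And>w. (\<forall>m. norm (w $ m) < r) \<Longrightarrow> P (p + w)"
  shows "\<forall>\<^sub>F q in nhds p. P q"
proof -
  have "open {q::'a ^ 3. \<forall>m. norm ((q - p) $ m) < r}"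
    using open_vimage[OF open_polydisc[of r], of "\<lambda>q. q - p"]
    by (simp add: vimage_def continuous_intros)
  then have "\<forall>\<^sub>F q in nhds p. q \<in> {q. \<forall>m. norm ((q - p) $ m) < r}"
    by (rule eventually_nhds_in_open) (use \<open>r > 0\<close> in auto)
  then show ?thesis
  proof eventually_elim
    case (elim q)
    then show ?case using assms(2)[of "q - p"] by simp
  qed
qed

lemma analytic3_kdiff:
  fixes F :: "'a::{real_normed_field,euclidean_space} ^ 3 \<Rightarrow> 'a"
  assumes "analytic3_at F p"
  shows "\<forall>\<^sub>F q in nhds p. kdiff F q"
proof -
  obtain c r where "r > 0" and ps: "\<And>w. (\<forall>m. norm (w $ m) < r) \<Longrightarrow> (mterm c w has_sum F (p + w)) UNIV"
    using assms unfolding analytic3_at_iff by auto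
  show ?thesis
    by (rule eventually_polydisc[OF \<open>r > 0\<close>]) (rule has_grad_imp_kdiff[OF power_series_has_grad(1)[OF ps]])
qed

text \<open>
  Both iterated derivatives are sums of one and the same power series.
\<close>

lemma analytic3_partial_commute:
  fixes F :: "'a::{real_normed_field,euclidean_space} ^ 3 \<Rightarrow> 'a"
  assumes "analytic3_at F p"
  shows "\<forall>\<^sub>F q in nhds p. partial m (partial n F) q = partial n (partial m F) q"
proof -
  obtain c r where "r > 0" and ps: "\<And>w. (\<forall>m. norm (w $ m) < r) \<Longrightarrow> (mterm c w has_sum F (p + w)) UNIV"
    using assms unfolding analytic3_at_iff by auto
  have "(mterm (dcoeff m (dcoeff n c)) w has_sum partial m (partial n F) (p + w)) UNIV"
    if "\<forall>m. norm (w $ m) < r" for w m n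
    using that by (intro power_series_partial[where r = r] ps)
  then show ?thesis
    by (intro eventually_polydisc[OF \<open>r > 0\<close>]) (metis dcoeff_commute has_sum_unique)
qed

section \<open>Twice differentiable functions\<close>

text \<open>
  The regularity that survives products and compositions and still allows an identity between first
  derivatives near a point to be differentiated once more there.
\<close>

definition twice_kdiff :: "('a::real_normed_field ^ 3 \<Rightarrow> 'a) \<Rightarrow> 'a ^ 3 \<Rightarrow> bool" where
  "twice_kdiff F p \<longleftrightarrow> (\<forall>\<^sub>F q in nhds p. kdiff F q \<and> (\<forall>m. kdiff (partial m F) q))"

lemma analytic3_twice_kdiff:
  fixes F :: "'a::{real_normed_field,euclidean_space} ^ 3 \<Rightarrow> 'a"
  assumes "analytic3_at F p"
  shows "twice_kdiff F p"
  unfolding twice_kdiff_def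
  by (intro eventually_conj analytic3_kdiff assms eventually_all_finite analytic3_partial)

lemma twice_kdiffD:
  assumes "twice_kdiff F p"
  shows "kdiff F p" "kdiff (partial m F) p"
  using eventually_nhds_x_imp_x[OF assms[unfolded twice_kdiff_def]] by auto

lemma partial_arith:
  assumes "kdiff F p" "kdiff G p"
  shows "partial m (\<lambda>q. F q - G q) p = partial m F p - partial m G p"
    and "partial m (\<lambda>q. F q + G q) p = partial m F p + partial m G p"
    and "partial m (\<lambda>q. F q * G q) p = F p * partial m G p + G p * partial m F p"
    and "kdiff (\<lambda>q. F q - G q) p" and "kdiff (\<lambda>q. F q + G q) p" and "kdiff (\<lambda>q. F q * G q) p"
proof -
  note F = assms(1)[unfolded kdiff_def] and G = assms(2)[unfolded kdiff_def]
  show "partial m (\<lambda>q. F q - G q) p = partial m F p - partial m G p" "kdiff (\<lambda>q. F q - G q) p"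
    using partial_eq[OF has_grad_diff[OF F G]] has_grad_imp_kdiff[OF has_grad_diff[OF F G]] by simp_all
  show "partial m (\<lambda>q. F q + G q) p = partial m F p + partial m G p" "kdiff (\<lambda>q. F q + G q) p"
    using partial_eq[OF has_grad_add[OF F G]] has_grad_imp_kdiff[OF has_grad_add[OF F G]] by simp_all
  show "partial m (\<lambda>q. F q * G q) p = F p * partial m G p + G p * partial m F p" "kdiff (\<lambda>q. F q * G q) p"
    using partial_eq[OF has_grad_mult[OF F G]] has_grad_imp_kdiff[OF has_grad_mult[OF F G]] by simp_all
qed

lemma partial_compose:
  fixes \<phi> :: "'a::{real_normed_field,euclidean_space} ^ 3 \<Rightarrow> 'a ^ 3"
  assumes "kdiff G (\<phi> p)" and "\<And>k. kdiff (\<lambda>q. \<phi> q $ k) p"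
  shows "partial m (\<lambda>q. G (\<phi> q)) p = (\<Sum>k\<in>UNIV. partial k G (\<phi> p) * partial m (\<lambda>q. \<phi> q $ k) p)"
    and "kdiff (\<lambda>q. G (\<phi> q)) p"
proof -
  have "has_grad (\<lambda>q. G (\<phi> q)) (\<chi> m. \<Sum>k\<in>UNIV. grad G (\<phi> p) $ k * grad (\<lambda>q. \<phi> q $ k) p $ m) p"
    using assms by (intro has_grad_compose) (simp_all add: kdiff_def)
  then show "partial m (\<lambda>q. G (\<phi> q)) p = (\<Sum>k\<in>UNIV. partial k G (\<phi> p) * partial m (\<lambda>q. \<phi> q $ k) p)"
    and "kdiff (\<lambda>q. G (\<phi> q)) p"
    by (simp_all add: partial_eq has_grad_imp_kdiff)
qed

lemma twice_kdiff_diff: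
  assumes "twice_kdiff F p" "twice_kdiff G p"
  shows "twice_kdiff (\<lambda>q. F q - G q) p"
proof -
  have "\<forall>\<^sub>F q in nhds p. \<forall>\<^sub>F q' in nhds q. (kdiff F q' \<and> (\<forall>m. kdiff (partial m F) q')) \<and> (kdiff G q' \<and> (\<forall>m. kdiff (partial m G) q'))"
    using eventually_conj[OF assms[unfolded twice_kdiff_def]] by (simp add: eventually_eventually)
  then show ?thesis unfolding twice_kdiff_def
  proof eventually_elim
    case (elim q)
    have "\<forall>\<^sub>F q' in nhds q. partial m (\<lambda>q. F q - G q) q' = partial m F q' - partial m G q'" for m
      using elim by eventually_elim (simp add: partial_arith)
    from kdiff_cong[OF this] show ?case
      using eventually_nhds_x_imp_x[OF elim] by (auto intro!: partial_arith)
  qed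
qed

lemma twice_kdiff_mult:
  assumes "twice_kdiff F p" "twice_kdiff G p"
  shows "twice_kdiff (\<lambda>q. F q * G q) p"
proof -
  have "\<forall>\<^sub>F q in nhds p. \<forall>\<^sub>F q' in nhds q. (kdiff F q' \<and> (\<forall>m. kdiff (partial m F) q')) \<and> (kdiff G q' \<and> (\<forall>m. kdiff (partial m G) q'))"
    using eventually_conj[OF assms[unfolded twice_kdiff_def]] by (simp add: eventually_eventually)
  then show ?thesis unfolding twice_kdiff_def
  proof eventually_elim
    case (elim q)
    have "\<forall>\<^sub>F q' in nhds q. partial m (\<lambda>q. F q * G q) q' = F q' * partial m G q' + G q' * partial m F q'" for m
      using elim by eventually_elim (simp add: partial_arith)
    from kdiff_cong[OF this] show ?case
      using eventually_nhds_x_imp_x[OF elim] by (auto intro!: partial_arith)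
  qed
qed

lemma twice_kdiff_compose:
  fixes \<phi> :: "'a::{real_normed_field,euclidean_space} ^ 3 \<Rightarrow> 'a ^ 3"
  assumes G: "twice_kdiff G (\<phi> p)" and \<phi>: "\<And>k. twice_kdiff (\<lambda>q. \<phi> q $ k) p"
  shows "twice_kdiff (\<lambda>q. G (\<phi> q)) p"
    and "\<forall>\<^sub>F q in nhds p. \<forall>m. partial m (\<lambda>q. G (\<phi> q)) q
      = (\<Sum>k\<in>UNIV. partial k G (\<phi> q) * partial m (\<lambda>q. \<phi> q $ k) q)"
proof -
  let ?D = "\<lambda>F q. kdiff F q \<and> (\<forall>m. kdiff (partial m F) q)"
  have "isCont (\<lambda>q. \<phi> q $ k) p" for k
    by (rule kdiff_isCont[OF twice_kdiffD(1)[OF \<phi>]])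
  then have "isCont \<phi> p"
    unfolding isCont_def by (intro vec_tendstoI)
  then have "filterlim \<phi> (nhds (\<phi> p)) (nhds p)"
    unfolding isCont_def by (rule tendsto_at_iff_tendsto_nhds[THEN iffD1])
  then have "\<forall>\<^sub>F q in nhds p. ?D G (\<phi> q)"
    using G unfolding twice_kdiff_def filterlim_iff by blast
  moreover have "\<forall>\<^sub>F q in nhds p. \<forall>k. ?D (\<lambda>q. \<phi> q $ k) q"
    using \<phi> unfolding twice_kdiff_def by (intro eventually_all_finite)
  ultimately have ev: "\<forall>\<^sub>F q in nhds p. ?D G (\<phi> q) \<and> (\<forall>k. ?D (\<lambda>q. \<phi> q $ k) q)"
    by (rule eventually_conj)
  then show "\<forall>\<^sub>F q in nhds p. \<forall>m. partial m (\<lambda>q. G (\<phi> q)) q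
      = (\<Sum>k\<in>UNIV. partial k G (\<phi> q) * partial m (\<lambda>q. \<phi> q $ k) q)"
    by eventually_elim (simp add: partial_compose)
  have "\<forall>\<^sub>F q in nhds p. \<forall>\<^sub>F q' in nhds q. ?D G (\<phi> q') \<and> (\<forall>k. ?D (\<lambda>q. \<phi> q $ k) q')"
    using ev by (simp add: eventually_eventually)
  then show "twice_kdiff (\<lambda>q. G (\<phi> q)) p" unfolding twice_kdiff_def
  proof eventually_elim
    case (elim q)
    have "\<forall>\<^sub>F q' in nhds q. partial m (\<lambda>q. G (\<phi> q)) q'
      = partial 1 G (\<phi> q') * partial m (\<lambda>q. \<phi> q $ 1) q' + partial 2 G (\<phi> q') * partial m (\<lambda>q. \<phi> q $ 2) q'
        + partial 3 G (\<phi> q') * partial m (\<lambda>q. \<phi> q $ 3) q'" for m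
      using elim by eventually_elim (simp add: partial_compose sum_3)
    note cong = kdiff_cong[OF this]
    have D: "?D G (\<phi> q) \<and> (\<forall>k. ?D (\<lambda>q. \<phi> q $ k) q)"
      using eventually_nhds_x_imp_x[OF elim] .
    have 1: "kdiff (\<lambda>q. partial k G (\<phi> q)) q" for k
      by (rule partial_compose(2)[of "partial k G" \<phi> q]) (simp_all add: D)
    have 2: "kdiff (partial m (\<lambda>q. \<phi> q $ k)) q" for k m
      using D by simp
    have "kdiff (partial m (\<lambda>q. G (\<phi> q))) q" for m
      unfolding cong by (rule partial_arith(5)[OF partial_arith(5)[OF
          partial_arith(6)[OF 1 2] partial_arith(6)[OF 1 2]] partial_arith(6)[OF 1 2]])
    moreover have "kdiff (\<lambda>q. G (\<phi> q)) q"
      by (rule partial_compose(2)) (simp_all add: D)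
    ultimately show ?case by simp
  qed
qed

section \<open>Functions constant on leaves\<close>

text \<open>
  A leaf is only a connected component, so a curve inside it has to be exhibited.  Completing \<open>(a, b)\<close>
  by a linear coordinate gives a local chart \<open>G\<close>; the preimage under \<open>G\<close> of a short segment through
  \<open>G p\<close> in the direction of the derivative of \<open>G\<close> along \<open>w\<close> is a curve through \<open>p\<close> with velocity \<open>w\<close>.
  If the differentials of \<open>a\<close> and \<open>b\<close> vanish on \<open>w\<close>, both functions are constant along it, so it lies
  in the leaf.  The conclusion holds at all points near \<open>p\<^sub>0\<close> and not just there, which allows it
  to be differentiated.
\<close>

lemma leaf_tangent:
  fixes a b :: "'a::{real_normed_field,euclidean_space} ^ 3 \<Rightarrow> 'a"
  assumes a: "twice_kdiff a p\<^sub>0" and b: "twice_kdiff b p\<^sub>0"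
    and inj0: "\<And>w. (\<Sum>m\<in>UNIV. partial m a p\<^sub>0 * w $ m) = 0 \<Longrightarrow>
      (\<Sum>m\<in>UNIV. partial m b p\<^sub>0 * w $ m) = 0 \<Longrightarrow> w $ k = 0 \<Longrightarrow> w = 0"
    and U: "open U" "p\<^sub>0 \<in> U"
  shows "\<forall>\<^sub>F p in nhds p\<^sub>0. \<forall>\<Psi> w. kdiff \<Psi> p \<longrightarrow> (\<forall>q\<in>foliation_of a b U p. \<Psi> q = \<Psi> p) \<longrightarrow>
      (\<Sum>m\<in>UNIV. partial m a p * w $ m) = 0 \<longrightarrow> (\<Sum>m\<in>UNIV. partial m b p * w $ m) = 0 \<longrightarrow>
      (\<Sum>m\<in>UNIV. partial m \<Psi> p * w $ m) = 0"
proof -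
  have "\<forall>\<^sub>F q in nhds p\<^sub>0. q \<in> U \<and> (kdiff a q \<and> (\<forall>m. kdiff (partial m a) q)) \<and> (kdiff b q \<and> (\<forall>m. kdiff (partial m b) q))"
    by (rule eventually_conj[OF eventually_nhds_in_open[OF U]
        eventually_conj[OF a[unfolded twice_kdiff_def] b[unfolded twice_kdiff_def]]])
  then obtain N where N: "open N" "p\<^sub>0 \<in> N" "N \<subseteq> U"
    and Na: "\<And>q. q \<in> N \<Longrightarrow> kdiff a q" "\<And>q m. q \<in> N \<Longrightarrow> kdiff (partial m a) q"
    and Nb: "\<And>q. q \<in> N \<Longrightarrow> kdiff b q" "\<And>q m. q \<in> N \<Longrightarrow> kdiff (partial m b) q"
    unfolding eventually_nhds by blast
  define G where "G q = (\<chi> i::3. if i = 1 then a q else if i = 2 then b q else q $ k)" for q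
  define L where "L q w = (\<chi> i::3. if i = 1 then (\<Sum>m\<in>UNIV. partial m a q * w $ m)
     else if i = 2 then (\<Sum>m\<in>UNIV. partial m b q * w $ m) else w $ k)" for q and w :: "'a ^ 3"
  have GL: "(G has_derivative L q) (at q)" if "q \<in> N" for q
  proof (rule has_derivative_components)
    fix i
    show "((\<lambda>q. G q $ i) has_derivative (\<lambda>w. L q w $ i)) (at q)"
      using Na(1)[OF that] Nb(1)[OF that]
      bounded_linear_imp_has_derivative[OF bounded_linear_vec_nth, of k "at q"]
      by (cases "i = 1"; cases "i = 2") (simp_all add: G_def L_def kdiff_def has_grad_def)
  qed
  have bl: "bounded_linear (L q)" if "q \<in> N" for q
    using GL[OF that] by (rule has_derivative_bounded_linear)
  define L' where "L' q = Blinfun (L q)" for q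
  have L': "blinfun_apply (L' q) = L q" if "q \<in> N" for q
    using bl[OF that] by (simp add: L'_def bounded_linear_Blinfun_apply)
  have cont: "continuous_on N L'"
  proof (rule continuous_on_blinfun_componentwise)
    fix w :: "'a ^ 3"
    have "continuous_on N (\<lambda>q. partial m a q)" "continuous_on N (\<lambda>q. partial m b q)" for m
      using kdiff_isCont[OF Na(2)] kdiff_isCont[OF Nb(2)] by (simp_all add: continuous_at_imp_continuous_on)
    then have "continuous_on N (\<lambda>q. L q w $ i)" for i
      by (cases "i = 1"; cases "i = 2") (auto simp: L_def intro!: continuous_intros)
    then have "continuous_on N (\<lambda>q. \<chi> i. L q w $ i)"
      by (intro continuous_on_vec_lambda)
    then show "continuous_on N (\<lambda>q. blinfun_apply (L' q) w)"
      using L' by (simp cong: continuous_on_cong)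
  qed
  have "inj (L p\<^sub>0)"
  proof (subst linear_injective_0[OF bounded_linear.linear[OF bl[OF N(2)]]], intro allI impI)
    fix w assume "L p\<^sub>0 w = 0"
    from this[unfolded vec_eq_iff, rule_format, of 1] this[unfolded vec_eq_iff, rule_format, of 2]
      this[unfolded vec_eq_iff, rule_format, of 3]
    show "w = 0" by (intro inj0) (auto simp: L_def)
  qed
  then obtain M where M: "linear M" "M \<circ> L p\<^sub>0 = id"
    using linear_injective_left_inverse[OF bounded_linear.linear[OF bl[OF N(2)]]] by blast
  have "Blinfun M o\<^sub>L L' p\<^sub>0 = id_blinfun"
    using M by (intro blinfun_eqI)
      (simp add: L'[OF N(2)] bounded_linear_Blinfun_apply linear_conv_bounded_linear pointfree_idE)
  then obtain U' V g g' where U': "open U'" "U' \<subseteq> N" "p\<^sub>0 \<in> U'" and V: "open V"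
    and hom: "homeomorphism U' V G g"
    and g: "\<And>y. y \<in> V \<Longrightarrow> (g has_derivative (g' y)) (at y)"
    and g': "\<And>y. y \<in> V \<Longrightarrow> g' y = inv (blinfun_apply (L' (g y)))"
    and bij: "\<And>y. y \<in> V \<Longrightarrow> bij (blinfun_apply (L' (g y)))"
    using inverse_function_theorem[OF N(1), of G L' p\<^sub>0 "Blinfun M"] GL L' cont N(2) by metis
  have "\<forall>\<^sub>F p in nhds p\<^sub>0. p \<in> U'"
    using U' by (simp add: eventually_nhds_in_open)
  then show ?thesis
  proof (eventually_elim, intro allI impI)
    fix p \<Psi> w
    assume p: "p \<in> U'" and \<Psi>: "kdiff \<Psi> p" and const: "\<forall>q\<in>foliation_of a b U p. \<Psi> q = \<Psi> p"
      and wa: "(\<Sum>m\<in>UNIV. partial m a p * w $ m) = 0" and wb: "(\<Sum>m\<in>UNIV. partial m b p * w $ m) = 0"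
    have GV: "G p \<in> V" and gG: "g (G p) = p"
      using hom p by (auto simp: homeomorphism_def)
    have pN: "p \<in> N" using p U' by auto
    define \<gamma> where "\<gamma> t = g (G p + t *\<^sub>R L p w)" for t :: real
    have "g' (G p) (L p w) = w"
      using g'[OF GV] bij[OF GV] by (simp add: gG L'[OF pN] bij_is_inj)
    moreover have lin: "linear (g' (G p))"
      using has_derivative_linear[OF g[OF GV]] .
    moreover have "((\<lambda>t. G p + t *\<^sub>R L p w) has_derivative (\<lambda>t. t *\<^sub>R L p w)) (at 0)"
      by (auto intro!: derivative_eq_intros)
    from has_derivative_compose[OF this, of g "g' (G p)"] g[OF GV]
    have "(\<gamma> has_derivative (\<lambda>t. g' (G p) (t *\<^sub>R L p w))) (at 0)"
      by (simp add: \<gamma>_def[abs_def])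
    ultimately have \<gamma>: "(\<gamma> has_derivative (\<lambda>t. t *\<^sub>R w)) (at 0)"
      by (simp add: linear_cmul)
    have \<gamma>0: "\<gamma> 0 = p" by (simp add: \<gamma>_def gG)
    have "open ((\<lambda>t. G p + t *\<^sub>R L p w) -` V)"
      using V by (intro open_vimage) (auto intro!: continuous_intros)
    moreover have "0 \<in> (\<lambda>t. G p + t *\<^sub>R L p w) -` V" using GV by simp
    ultimately obtain e where e: "e > 0" "ball 0 e \<subseteq> (\<lambda>t. G p + t *\<^sub>R L p w) -` V"
      using open_contains_ball by blast
    have \<gamma>U: "\<gamma> t \<in> U'" "G (\<gamma> t) = G p + t *\<^sub>R L p w" if "t \<in> ball 0 e" for t
      using e(2) that hom by (auto simp: \<gamma>_def homeomorphism_def)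
    have "\<gamma> ` ball 0 e \<subseteq> {q \<in> U. a q = a p \<and> b q = b p}"
    proof (rule image_subsetI)
      fix t :: real assume t: "t \<in> ball 0 e"
      have "G (\<gamma> t) $ 1 = G p $ 1" "G (\<gamma> t) $ 2 = G p $ 2"
        unfolding \<gamma>U(2)[OF t] using wa wb by (simp_all add: L_def)
      then show "\<gamma> t \<in> {q \<in> U. a q = a p \<and> b q = b p}"
        using \<gamma>U(1)[OF t] U' N by (auto simp: G_def)
    qed
    moreover have "connected (\<gamma> ` ball 0 e)"
    proof (rule connected_continuous_image)
      show "continuous_on (ball 0 e) \<gamma>"
        unfolding \<gamma>_def
      proof (rule continuous_on_compose2[of V g])
        show "continuous_on V g" using hom by (simp add: homeomorphism_def)
      qed (use e in \<open>auto intro!: continuous_intros\<close>)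
    qed simp
    moreover have "p \<in> \<gamma> ` ball 0 e" using e(1) \<gamma>0 by (intro image_eqI[of _ _ 0]) auto
    ultimately have "\<gamma> ` ball 0 e \<subseteq> foliation_of a b U p"
      unfolding foliation_of_def by (intro connected_component_maximal)
    then have "\<Psi> (\<gamma> t) = \<Psi> p" if "t \<in> ball 0 e" for t
      using const that by blast
    then have 0: "((\<lambda>t. \<Psi> (\<gamma> t)) has_derivative (\<lambda>t. 0)) (at 0)"
      using e(1) by (intro has_derivative_transform_within_open[OF has_derivative_const open_ball, of 0 0 e]) auto
    have "((\<lambda>t. \<Psi> (\<gamma> t)) has_derivative (\<lambda>t. \<Sum>m\<in>UNIV. partial m \<Psi> p * (t *\<^sub>R w) $ m)) (at 0)"
      using has_derivative_compose[OF \<gamma>, of \<Psi> "\<lambda>w. \<Sum>m\<in>UNIV. partial m \<Psi> p * w $ m"] \<Psi> by (simp add: kdiff_def has_grad_def \<gamma>0)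
    from has_derivative_unique[OF this 0] have "(\<Sum>m\<in>UNIV. partial m \<Psi> p * (1 *\<^sub>R w) $ m) = 0"
      by meson
    then show "(\<Sum>m\<in>UNIV. partial m \<Psi> p * w $ m) = 0" by simp
  qed
qed

text \<open>
  At the origin the first three foliations differ by a cyclic permutation of the coordinates: the \<open>i\<close>-th one has
  basic functions \<open>x\<^sub>i\<close> and \<open>a\<^sub>i = x\<^sub>n + \<dots>\<close> and is directed along the \<open>d\<close>-th axis at the origin.
\<close>

definition cyclic :: "3 \<Rightarrow> 3 \<Rightarrow> 3 \<Rightarrow> bool" where
  "cyclic i n d \<longleftrightarrow> (i, n, d) \<in> {(1, 2, 3), (2, 3, 1), (3, 1, 2)}"

lemma sum_cyclic: "cyclic i n d \<Longrightarrow> (\<Sum>m\<in>UNIV. f m) = f i + f n + f d"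
  by (auto simp: cyclic_def sum_3 algebra_simps)

lemma cyclic_distinct: "cyclic i n d \<Longrightarrow> i \<noteq> n" "cyclic i n d \<Longrightarrow> n \<noteq> d" "cyclic i n d \<Longrightarrow> d \<noteq> i"
  by (auto simp: cyclic_def)

lemma cyclic_cases: "cyclic i n d \<Longrightarrow> k = i \<or> k = n \<or> k = d"
  using exhaust_3[of k] by (auto simp: cyclic_def)

lemma cyclic_rotate: "cyclic i n d \<Longrightarrow> cyclic n d i"
  by (auto simp: cyclic_def)

lemma partial_coord [simp]: "partial m (\<lambda>q. q $ k) p = (if m = k then 1 else 0)"
  using partial_eq[OF has_grad_coord, of m k p] by (auto simp: axis_def)

lemma kdiff_coord [simp]: "kdiff (\<lambda>q. q $ k) p"
  by (rule has_grad_imp_kdiff[OF has_grad_coord])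

lemma kdiff_const [simp]: "kdiff (\<lambda>q. c) p"
  by (rule has_grad_imp_kdiff[OF has_grad_const])

lemma twice_kdiff_coord: "twice_kdiff (\<lambda>q. q $ k) p"
proof -
  have "partial m (\<lambda>q. q $ k) = (\<lambda>q::'a ^ 3. if m = k then 1 else 0)" for m
    by (rule ext) simp
  then show ?thesis by (simp add: twice_kdiff_def)
qed

text \<open>
  The relation is \<open>leaf_tangent\<close> for the vector with entries \<open>a\<^sub>n\<close> in place \<open>d\<close> and \<open>- a\<^sub>d\<close> in place
  \<open>n\<close>, on which the differentials of \<open>x\<^sub>i\<close> and \<open>a\<close> vanish.
\<close>

lemma first_integral_relation:
  fixes a :: "'a::{real_normed_field,euclidean_space} ^ 3 \<Rightarrow> 'a"
  assumes a: "twice_kdiff a 0" "cyclic i n d" "partial n a 0 = 1" and U: "open U" "0 \<in> U"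
  shows "\<forall>\<^sub>F p in nhds 0. \<forall>\<Psi>. kdiff \<Psi> p \<longrightarrow>
      (\<forall>q\<in>foliation_of a (\<lambda>p. p $ i) U p. \<Psi> q = \<Psi> p) \<longrightarrow>
      partial d \<Psi> p * partial n a p = partial n \<Psi> p * partial d a p"
proof -
  note s = sum_cyclic[OF a(2)] and dist = cyclic_distinct[OF a(2)] and dist' = cyclic_distinct[OF a(2), symmetric]
  have "\<forall>\<^sub>F p in nhds 0. \<forall>\<Psi> w. kdiff \<Psi> p \<longrightarrow>
      (\<forall>q\<in>foliation_of a (\<lambda>p. p $ i) U p. \<Psi> q = \<Psi> p) \<longrightarrow>
      (\<Sum>m\<in>UNIV. partial m a p * w $ m) = 0 \<longrightarrow> (\<Sum>m\<in>UNIV. partial m (\<lambda>p. p $ i) p * w $ m) = 0 \<longrightarrow>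
      (\<Sum>m\<in>UNIV. partial m \<Psi> p * w $ m) = 0"
  proof (rule leaf_tangent[where k = d])
    fix w
    assume "(\<Sum>m\<in>UNIV. partial m a 0 * w $ m) = 0" "(\<Sum>m\<in>UNIV. partial m (\<lambda>p::'a ^ 3. p $ i) 0 * w $ m) = 0"
      "w $ d = 0"
    then have "w $ i = 0 \<and> w $ n = 0 \<and> w $ d = 0"
      using dist dist' a(3) by (simp add: s)
    then have "w $ k = 0" for k using cyclic_cases[OF a(2), of k] by auto
    then show "w = 0" by (simp add: vec_eq_iff)
  qed (use a U twice_kdiff_coord in auto)
  then show ?thesis
  proof (eventually_elim, intro allI impI)
    fix p \<Psi>
    assume h: "\<forall>\<Psi> w. kdiff \<Psi> p \<longrightarrow>
      (\<forall>q\<in>foliation_of a (\<lambda>p. p $ i) U p. \<Psi> q = \<Psi> p) \<longrightarrow>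
      (\<Sum>m\<in>UNIV. partial m a p * w $ m) = 0 \<longrightarrow> (\<Sum>m\<in>UNIV. partial m (\<lambda>p. p $ i) p * w $ m) = 0 \<longrightarrow>
      (\<Sum>m\<in>UNIV. partial m \<Psi> p * w $ m) = 0"
      and \<Psi>: "kdiff \<Psi> p" "\<forall>q\<in>foliation_of a (\<lambda>p. p $ i) U p. \<Psi> q = \<Psi> p"
    show "partial d \<Psi> p * partial n a p = partial n \<Psi> p * partial d a p"
      using h[rule_format, OF \<Psi>(1), of "\<chi> m. if m = n then - partial d a p else if m = d then partial n a p else 0"]
        \<Psi>(2) dist dist' by (simp add: s algebra_simps)
  qed
qed

text \<open>
  In the derivative of the relation at the origin, the products with a factor \<open>\<Psi>\<^sub>d(0)\<close> or \<open>a\<^sub>d(0)\<close>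
  vanish.
\<close>

lemma first_integral_jet:
  assumes rel: "\<forall>\<^sub>F p in nhds 0. partial d \<Psi> p * partial n a p = partial n \<Psi> p * partial d a p"
    and tw: "twice_kdiff \<Psi> 0" "twice_kdiff a 0" and a: "partial n a 0 = 1" "partial d a 0 = 0"
  shows "partial d \<Psi> 0 = 0"
    and "partial l (partial d \<Psi>) 0 = partial n \<Psi> 0 * partial l (partial d a) 0"
proof -
  show d0: "partial d \<Psi> 0 = 0"
    using eventually_nhds_x_imp_x[OF rel] a by simp
  show "partial l (partial d \<Psi>) 0 = partial n \<Psi> 0 * partial l (partial d a) 0"
    using partial_cong[OF rel, of l] a d0
    by (simp add: partial_arith(3) twice_kdiffD(2)[OF tw(1)] twice_kdiffD(2)[OF tw(2)])
qed

section \<open>The torsion of a normalized web\<close>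

definition web_fn :: "3 \<Rightarrow> ('a::real_normed_field ^ 3 \<Rightarrow> 'a) \<Rightarrow> ('a ^ 3 \<Rightarrow> 'a) \<Rightarrow> ('a ^ 3 \<Rightarrow> 'a) \<Rightarrow> 'a ^ 3 \<Rightarrow> 'a" where
  "web_fn i Q u v = (\<lambda>p. partial i Q p - u p * partial i v p)"

lemma web_eq:
  "web Q u v = [foliation_of (web_fn 1 Q u v) (\<lambda>p. p $ 1), foliation_of (web_fn 2 Q u v) (\<lambda>p. p $ 2),
     foliation_of (web_fn 3 Q u v) (\<lambda>p. p $ 3), foliation_of u v]"
  by (simp add: web_def web_fn_def Let_def)

lemma linear_normal_form:
  fixes u :: "'a::{real_normed_field,euclidean_space} ^ 3 \<Rightarrow> 'a"
  assumes "analytic3_at u 0" and "order_at_least 2 (\<lambda>p. u p - (p $ a - p $ b))"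
  shows "u 0 = 0" and "partial m u 0 = (if m = a then 1 else 0) - (if m = b then 1 else 0)"
proof -
  let ?R = "\<lambda>p. u p - (p $ a - p $ b)"
  have ord: "taylor ?R i j k = 0" if "i + j + k < 2" for i j k
    using assms(2) that unfolding order_at_least_def by blast
  show "u 0 = 0" using ord[of 0 0 0] by (simp add: taylor_def)
  have "partial 1 ?R 0 = 0" "partial 2 ?R 0 = 0" "partial 3 ?R 0 = 0"
    using ord[of 1 0 0] ord[of 0 1 0] ord[of 0 0 1] by (simp_all add: taylor_def)
  then have "partial m ?R 0 = 0" using exhaust_3[of m] by auto
  moreover have "partial m ?R 0 = partial m u 0 - (partial m (\<lambda>p. p $ a) 0 - partial m (\<lambda>p. p $ b) 0)"
    using twice_kdiffD(1)[OF analytic3_twice_kdiff[OF assms(1)]] by (simp only: partial_arith kdiff_coord)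
  ultimately show "partial m u 0 = (if m = a then 1 else 0) - (if m = b then 1 else 0)"
    by simp
qed

lemma quadratic_normal_form:
  fixes Q :: "'a::{real_normed_field,euclidean_space} ^ 3 \<Rightarrow> 'a"
  assumes Q: "analytic3_at Q 0" and "order_at_least 3 (\<lambda>p. Q p - ((p $ 1)\<^sup>2 / 2 + p $ 2 * p $ 3))"
  shows "partial 1 (partial 2 Q) 0 = 0" "partial 1 (partial 3 Q) 0 = 0" "partial 2 (partial 3 Q) 0 = 1"
    "partial 2 (partial 1 Q) 0 = 0" "partial 3 (partial 1 Q) 0 = 0" "partial 3 (partial 2 Q) 0 = 1"
proof -
  let ?P = "\<lambda>p::'a ^ 3. (p $ 1)\<^sup>2 / 2 + p $ 2 * p $ 3"
  let ?R = "\<lambda>p. Q p - ?P p"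
  have P: "has_grad ?P (vector [p $ 1, p $ 3, p $ 2]) p" for p :: "'a ^ 3"
    unfolding has_grad_def
    by (auto intro!: derivative_eq_intros bounded_linear.has_derivative[OF bounded_linear_vec_nth]
      simp: sum_3 algebra_simps)
  have ord: "taylor ?R i j k = 0" if "i + j + k < 3" for i j k
    using assms(2) that unfolding order_at_least_def by blast
  have ev: "\<forall>\<^sub>F p in nhds 0. partial i ?R p = partial i Q p - (vector [p $ 1, p $ 3, p $ 2] :: 'a ^ 3) $ i" for i
    using analytic3_kdiff[OF Q]
    by eventually_elim (simp only: partial_arith(1) has_grad_imp_kdiff[OF P] partial_eq[OF P])
  have kQ: "kdiff (partial i Q) 0" for i
    by (rule twice_kdiffD(2)[OF analytic3_twice_kdiff[OF Q]])
  have c2: "\<forall>\<^sub>F p in nhds 0. partial 2 ?R p = partial 2 Q p - p $ 3"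
    and c3: "\<forall>\<^sub>F p in nhds 0. partial 3 ?R p = partial 3 Q p - p $ 2"
    using ev[of 2] ev[of 3] by simp_all
  have "partial 1 (partial 2 ?R) 0 = 0" "partial 1 (partial 3 ?R) 0 = 0" "partial 2 (partial 3 ?R) 0 = 0"
    using ord[of 1 1 0] ord[of 1 0 1] ord[of 0 1 1] by (simp_all add: taylor_def)
  moreover have "partial m (partial 2 ?R) 0 = partial m (partial 2 Q) 0 - partial m (\<lambda>p. p $ 3) 0"
    "partial m (partial 3 ?R) 0 = partial m (partial 3 Q) 0 - partial m (\<lambda>p. p $ 2) 0" for m
    using partial_cong[OF c2, of m] partial_cong[OF c3, of m]
    by (simp_all only: partial_arith(1)[OF kQ kdiff_coord])
  ultimately show *: "partial 1 (partial 2 Q) 0 = 0" "partial 1 (partial 3 Q) 0 = 0" "partial 2 (partial 3 Q) 0 = 1"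
    by simp_all
  have "partial m (partial n Q) 0 = partial n (partial m Q) 0" for m n
    using eventually_nhds_x_imp_x[OF analytic3_partial_commute[OF Q]] .
  then show "partial 2 (partial 1 Q) 0 = 0" "partial 3 (partial 1 Q) 0 = 0" "partial 3 (partial 2 Q) 0 = 1"
    using * by metis+
qed

context
  fixes Q u v :: "'a::{real_normed_field,euclidean_space} ^ 3 \<Rightarrow> 'a"
  assumes norm: "normalized Q u v"
begin

lemma normalized_analytic: "analytic3_at Q 0" "analytic3_at u 0" "analytic3_at v 0"
  using norm by (auto simp: normalized_def)

lemma normalized_jets:
  "u 0 = 0" "partial 1 u 0 = -1" "partial 2 u 0 = 1" "partial 3 u 0 = 0"
  "partial 1 v 0 = -1" "partial 2 v 0 = 0" "partial 3 v 0 = 1"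
  using norm linear_normal_form[of u 2 1] linear_normal_form[of v 3 1]
  by (auto simp: normalized_def)

lemma twice_kdiff_web_fn: "twice_kdiff (web_fn i Q u v) 0"
  unfolding web_fn_def
  by (intro twice_kdiff_diff twice_kdiff_mult analytic3_twice_kdiff analytic3_partial normalized_analytic)

lemma partial_web_fn:
  "\<forall>\<^sub>F p in nhds 0. partial m (web_fn i Q u v) p
    = partial m (partial i Q) p - (u p * partial m (partial i v) p + partial i v p * partial m u p)"
  using analytic3_kdiff[OF analytic3_partial[OF normalized_analytic(1), of i]]
    analytic3_kdiff[OF normalized_analytic(2)]
    analytic3_kdiff[OF analytic3_partial[OF normalized_analytic(3), of i]]
  by eventually_elim (simp add: web_fn_def partial_arith)

lemma web_fn_jet:
  assumes "cyclic i n d"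
  shows "partial n (web_fn i Q u v) 0 = 1" "partial d (web_fn i Q u v) 0 = 0"
proof -
  have *: "partial m (web_fn i Q u v) 0 = partial m (partial i Q) 0 - partial i v 0 * partial m u 0" for m i
    using eventually_nhds_x_imp_x[OF partial_web_fn[of m i]] by (simp add: normalized_jets)
  note q = quadratic_normal_form[OF normalized_analytic(1)]
  have ord: "order_at_least 3 (\<lambda>p. Q p - ((p $ 1)\<^sup>2 / 2 + p $ 2 * p $ 3))"
    using norm by (simp add: normalized_def)
  show "partial n (web_fn i Q u v) 0 = 1" "partial d (web_fn i Q u v) 0 = 0"
    using assms unfolding * cyclic_def by (auto simp: normalized_jets q[OF ord])
qed

lemma partial2_web_fn:
  "partial l (partial m (web_fn i Q u v)) 0 = partial l (partial m (partial i Q)) 0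
    - (partial m (partial i v) 0 * partial l u 0
       + (partial i v 0 * partial l (partial m u) 0 + partial m u 0 * partial l (partial i v) 0))"
proof -
  note kd = twice_kdiffD[OF analytic3_twice_kdiff]
  have "partial l (partial m (web_fn i Q u v)) 0 = partial l (\<lambda>p. partial m (partial i Q) p -
      (u p * partial m (partial i v) p + partial i v p * partial m u p)) 0"
    by (rule partial_cong[OF partial_web_fn])
  also have "\<dots> = partial l (partial m (partial i Q)) 0 - (
       u 0 * partial l (partial m (partial i v)) 0 + partial m (partial i v) 0 * partial l u 0
       + (partial i v 0 * partial l (partial m u) 0 + partial m u 0 * partial l (partial i v) 0))"
    by (simp only: partial_arith kd(1)[OF analytic3_partial[OF analytic3_partial]] kd(1)[OF analytic3_partial]
      kd(1) normalized_analytic)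
  finally show ?thesis by (simp add: normalized_jets)
qed

text \<open>
  Up to sign, this is the obstruction to integrating the planes spanned by the second and the third
  foliation.
\<close>

lemma inv_numer_eq: "inv_numer Q u v = partial 2 (partial 1 (web_fn 2 Q u v)) 0"
proof -
  have "partial m (partial n F) 0 = partial n (partial m F) 0" if "analytic3_at F 0" for m n and F :: "'a ^ 3 \<Rightarrow> 'a"
    using eventually_nhds_x_imp_x[OF analytic3_partial_commute[OF that]] .
  from this[OF normalized_analytic(3), of 1 2] this[OF analytic3_partial[OF normalized_analytic(1), of 2], of 1 2]
  show ?thesis
    unfolding partial2_web_fn by (simp add: inv_numer_def taylor_def normalized_jets numeral_2_eq_2 fact_2)
qed

text \<open>
  Up to sign, this is the obstruction to integrating the planes spanned by the first and the second
  foliation.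
\<close>

lemma inv_denom_eq: "inv_denom Q u v = partial 1 (partial 3 (web_fn 1 Q u v)) 0"
proof -
  have c: "\<forall>\<^sub>F p in nhds 0. partial m (partial n F) p = partial n (partial m F) p" if "analytic3_at F 0" for m n and F :: "'a ^ 3 \<Rightarrow> 'a"
    using analytic3_partial_commute[OF that] .
  show ?thesis
    unfolding partial2_web_fn
    using partial_cong[OF c[OF normalized_analytic(1), of 1 3], of 1]
      eventually_nhds_x_imp_x[OF c[OF normalized_analytic(3), of 1 3]]
    by (simp add: inv_denom_def taylor_def normalized_jets numeral_2_eq_2 fact_2)
qed

end

section \<open>Isomorphisms rescale the torsion\<close>

lemma foliation_of_level:
  "q \<in> foliation_of a b U p \<Longrightarrow> a q = a p \<and> b q = b p"
  unfolding foliation_of_def using connected_component_subset by fastforce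

lemma leaf_preserving_const:
  assumes "\<forall>p\<in>U. \<phi> ` foliation_of a b U p = foliation_of a' b' V (\<phi> p)" "p \<in> U"
    and "q \<in> foliation_of a b U p"
  shows "a' (\<phi> q) = a' (\<phi> p)" "b' (\<phi> q) = b' (\<phi> p)"
  using foliation_of_level[of "\<phi> q" a' b' V "\<phi> p"] assms by blast+

text \<open>
  For each of the first three foliations, \<open>\<phi>\<^sub>i\<close> and \<open>F\<^sub>i = a'\<^sub>i \<circ> \<phi>\<close> are constant on the leaves.  At the
  origin their derivatives along the foliation vanish, which kills the off-diagonal part of the
  derivative of \<open>\<phi>\<close>; the fourth foliation, with direction \<open>(1, 1, 1)\<close>, makes its diagonal constant.
  By the chain rule,
  \<open>\<partial>\<^sub>i \<partial>\<^sub>d F\<^sub>i = \<mu>\<^sup>2 \<partial>\<^sub>i \<partial>\<^sub>d a'\<^sub>i + \<partial>\<^sub>i \<partial>\<^sub>d \<phi>\<^sub>n\<close>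
  at the origin, all other terms being zero, and the last summand is zero by the relation for the
  \<open>n\<close>-th foliation.  The relation for \<open>F\<^sub>i\<close> itself identifies the left-hand side with
  \<open>\<mu> \<partial>\<^sub>i \<partial>\<^sub>d a\<^sub>i\<close>.
\<close>

lemma torsion_scaling:
  fixes Q u v Q' u' v' :: "'a::{real_normed_field,euclidean_space} ^ 3 \<Rightarrow> 'a"
  assumes n: "normalized Q u v" and n': "normalized Q' u' v'"
    and iso: "web_isomorphic (web Q u v) (web Q' u' v')"
  obtains \<mu> where "\<mu> \<noteq> 0"
    and "\<And>i n d. cyclic i n d \<Longrightarrow>
      partial i (partial d (web_fn i Q u v)) 0 = \<mu> * partial i (partial d (web_fn i Q' u' v')) 0"
proof -
  define a where "a i = web_fn i Q u v" for i
  define a' where "a' i = web_fn i Q' u' v'" for i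
  obtain U V \<phi> where U: "open U" "0 \<in> U" and V: "open V" and \<phi>0: "\<phi> 0 = 0" and bij: "bij_betw \<phi> U V"
    and an: "analytic3_map_on \<phi> U" and an': "analytic3_map_on (inv_into U \<phi>) V"
    and lv: "list_all2 (\<lambda>\<F> \<F>'. \<forall>p\<in>U. \<phi> ` \<F> U p = \<F>' V (\<phi> p)) (web Q u v) (web Q' u' v')"
    using iso unfolding web_isomorphic_def by blast
  have L: "\<forall>p\<in>U. \<phi> ` foliation_of (a i) (\<lambda>p. p $ i) U p = foliation_of (a' i) (\<lambda>p. p $ i) V (\<phi> p)" for i
    using exhaust_3[of i] lv unfolding web_eq a_def a'_def by (elim disjE) simp_all
  have L4: "\<forall>p\<in>U. \<phi> ` foliation_of u v U p = foliation_of u' v' V (\<phi> p)"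
    using lv unfolding web_eq by simp
  define f where "f k = (\<lambda>p. \<phi> p $ k)" for k
  have an_f: "analytic3_at (f k) 0" for k
    using an U by (simp add: analytic3_map_on_def f_def)
  have tf: "twice_kdiff (\<lambda>p. \<phi> p $ k) 0" for k
    using analytic3_twice_kdiff[OF an_f] by (simp add: f_def)
  have ta: "twice_kdiff (a i) 0" and ta': "twice_kdiff (a' i) (\<phi> 0)" for i
    using twice_kdiff_web_fn[OF n] twice_kdiff_web_fn[OF n'] by (simp_all add: a_def a'_def \<phi>0)
  define F where "F i = (\<lambda>p. a' i (\<phi> p))" for i
  have tF: "twice_kdiff (F i) 0" for i
    unfolding F_def by (rule twice_kdiff_compose(1)[OF ta' tf])
  have dF: "\<forall>\<^sub>F q in nhds 0. \<forall>m. partial m (F i) q = (\<Sum>k\<in>UNIV. partial k (a' i) (\<phi> q) * partial m (f k) q)" for i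
    using twice_kdiff_compose(2)[OF ta' tf] by (simp add: F_def f_def)
  have dF0: "partial m (F i) 0 = (\<Sum>k\<in>UNIV. partial k (a' i) 0 * partial m (f k) 0)" for i m
    using eventually_nhds_x_imp_x[OF dF] \<phi>0 by simp
  have jets: "partial n (a i) 0 = 1" "partial d (a i) 0 = 0" "partial n (a' i) 0 = 1" "partial d (a' i) 0 = 0"
    if "cyclic i n d" for i n d
    using web_fn_jet[OF n that] web_fn_jet[OF n' that] by (simp_all add: a_def a'_def)
  have rel: "\<forall>\<^sub>F p in nhds 0. partial d \<Psi> p * partial n (a i) p = partial n \<Psi> p * partial d (a i) p"
    if c: "cyclic i n d" and \<Psi>: "\<Psi> = f i \<or> \<Psi> = F i" and "twice_kdiff \<Psi> 0" for i n d \<Psi>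
  proof -
    have "\<forall>\<^sub>F p in nhds 0. kdiff \<Psi> p" using \<open>twice_kdiff \<Psi> 0\<close> by (auto simp: twice_kdiff_def elim: eventually_mono)
    moreover have "\<forall>\<^sub>F p in nhds 0. p \<in> U" using U by (simp add: eventually_nhds_in_open)
    ultimately show ?thesis
      using first_integral_relation[OF ta c jets(1)[OF c] U]
    proof eventually_elim
      case (elim p)
      have "\<forall>q\<in>foliation_of (a i) (\<lambda>p. p $ i) U p. \<Psi> q = \<Psi> p"
        using \<Psi> leaf_preserving_const[OF L \<open>p \<in> U\<close>] by (auto simp: f_def F_def)
      then show ?case using elim by blast
    qed
  qed
  have tff: "twice_kdiff (f i) 0" for i using tf by (simp add: f_def)
  have jf: "partial d (f i) 0 = 0" "partial l (partial d (f i)) 0 = partial n (f i) 0 * partial l (partial d (a i)) 0"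
    if "cyclic i n d" for i n d l
    by (rule first_integral_jet[OF rel[OF that disjI1[OF refl] tff] tff ta jets(1,2)[OF that]])+
  have jF: "partial d (F i) 0 = 0" "partial l (partial d (F i)) 0 = partial n (F i) 0 * partial l (partial d (a i)) 0"
    if "cyclic i n d" for i n d l
    by (rule first_integral_jet[OF rel[OF that disjI2[OF refl] tF] tF ta jets(1,2)[OF that]])+
  \<comment> \<open>At the origin the differential of \<open>a' i\<close> is \<open>dx\<^sub>n\<close> plus a multiple of \<open>dx\<^sub>i\<close>; as \<open>f i\<close> is settled, \<open>F i\<close> yields \<open>f n\<close>.\<close>
  have off: "partial d (f n) 0 = 0" if c: "cyclic i n d" for i n d
    using jF(1)[OF c] jf(1)[OF c] by (simp add: dF0 sum_cyclic[OF c] jets[OF c])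
  define \<mu> where "\<mu> = partial 1 (f 1) 0"
  have offdiag: "partial m (f k) 0 = 0" if "m \<noteq> k" for m k
    using that exhaust_3[of m] exhaust_3[of k] jf(1)[of 1 2 3] jf(1)[of 2 3 1] jf(1)[of 3 1 2]
      off[of 1 2 3] off[of 2 3 1] off[of 3 1 2] by (auto simp: cyclic_def)
  have diag4: "partial k (f k) 0 = \<mu>" if k: "k = 2 \<and> w = u' \<or> k = 3 \<and> w = v'" for k w
  proof -
    have tw: "twice_kdiff w (\<phi> 0)" using k analytic3_twice_kdiff normalized_analytic[OF n'] \<phi>0 by auto
    have "\<forall>\<^sub>F p in nhds 0. \<forall>\<Psi> w. kdiff \<Psi> p \<longrightarrow> (\<forall>q\<in>foliation_of u v U p. \<Psi> q = \<Psi> p) \<longrightarrow>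
      (\<Sum>m\<in>UNIV. partial m u p * w $ m) = 0 \<longrightarrow> (\<Sum>m\<in>UNIV. partial m v p * w $ m) = 0 \<longrightarrow>
      (\<Sum>m\<in>UNIV. partial m \<Psi> p * w $ m) = 0"
      by (rule leaf_tangent[where k = 1])
        (auto simp: U analytic3_twice_kdiff normalized_analytic[OF n] sum_3 normalized_jets[OF n] vec_eq_iff forall_3)
    then have "\<forall>\<Psi> w. kdiff \<Psi> 0 \<longrightarrow> (\<forall>q\<in>foliation_of u v U 0. \<Psi> q = \<Psi> 0) \<longrightarrow>
      (\<Sum>m\<in>UNIV. partial m u 0 * w $ m) = 0 \<longrightarrow> (\<Sum>m\<in>UNIV. partial m v 0 * w $ m) = 0 \<longrightarrow>
      (\<Sum>m\<in>UNIV. partial m \<Psi> 0 * w $ m) = 0"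
      by (rule eventually_nhds_x_imp_x)
    \<comment> \<open>The fourth foliation is tangent to \<open>(1, 1, 1)\<close> at the origin.\<close>
    from this[rule_format, of "\<lambda>p. w (\<phi> p)" "vector [1, 1, 1]"]
    have "(\<Sum>m\<in>UNIV. partial m (\<lambda>p. w (\<phi> p)) 0) = 0"
      using twice_kdiffD(1)[OF twice_kdiff_compose(1)[OF tw tf]] leaf_preserving_const[OF L4 U(2)] k
      by (auto simp: sum_3 normalized_jets[OF n])
    moreover have "partial m (\<lambda>p. w (\<phi> p)) 0 = (\<Sum>k\<in>UNIV. partial k w 0 * partial m (f k) 0)" for m
      using eventually_nhds_x_imp_x[OF twice_kdiff_compose(2)[OF tw tf]] \<phi>0 by (simp add: f_def)
    ultimately show ?thesis
      using k by (auto simp: sum_3 offdiag normalized_jets[OF n'] \<mu>_def)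
  qed
  have diag: "partial k (f k) 0 = \<mu>" for k
    using exhaust_3[of k] diag4[of 2 u'] diag4[of 3 v'] by (auto simp: \<mu>_def)
  have "\<mu> \<noteq> 0"
  proof
    assume "\<mu> = 0"
    \<comment> \<open>If the derivative of \<open>\<phi>\<close> vanished, so would that of the identity, which is the inverse after \<open>\<phi>\<close>.\<close>
    define \<psi> where "\<psi> = (\<lambda>q. inv_into U \<phi> q $ 1)"
    have "0 \<in> V" using bij U \<phi>0 by (metis bij_betwE)
    then have "analytic3_at \<psi> (\<phi> 0)"
      using an' by (simp add: analytic3_map_on_def \<psi>_def \<phi>0)
    then have "partial 1 (\<lambda>q. \<psi> (\<phi> q)) 0 = (\<Sum>k\<in>UNIV. partial k \<psi> (\<phi> 0) * partial 1 (f k) 0)"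
      using twice_kdiffD(1)[OF tf] twice_kdiffD(1)[OF analytic3_twice_kdiff] unfolding f_def by (intro partial_compose(1))
    also have "\<dots> = 0" using \<open>\<mu> = 0\<close> by (simp add: sum_3 offdiag \<mu>_def)
    also have "partial 1 (\<lambda>q. \<psi> (\<phi> q)) 0 = partial 1 (\<lambda>q::'a ^ 3. q $ 1) 0"
    proof (rule partial_cong)
      have "\<forall>\<^sub>F q in nhds 0. q \<in> U" using U by (simp add: eventually_nhds_in_open)
      then show "\<forall>\<^sub>F q in nhds 0. \<psi> (\<phi> q) = q $ 1"
        by eventually_elim (simp add: \<psi>_def bij_betw_inv_into_left[OF bij])
    qed
    finally show False by simp
  qed
  moreover have "partial i (partial d (a i)) 0 = \<mu> * partial i (partial d (a' i)) 0" if c: "cyclic i n d" for i n d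
  proof -
    note dist = cyclic_distinct[OF c] cyclic_distinct[OF c, symmetric]
    have zero_i: "partial i (partial d (f i)) 0 = 0"
      using jf(2)[OF c, of i] offdiag[of n i] dist by simp
    \<comment> \<open>The direction of the \<open>n\<close>-th foliation is the \<open>i\<close>-th axis, so its relation applies after exchanging the two derivatives.\<close>
    have "partial d (partial i (f n)) 0 = 0"
      using jf(2)[OF cyclic_rotate[OF c], of d] offdiag[of d n] dist by simp
    then have zero_n: "partial i (partial d (f n)) 0 = 0"
      using eventually_nhds_x_imp_x[OF analytic3_partial_commute[OF an_f[of n], of i d]] by simp
    have ka': "kdiff (\<lambda>q. partial k (a' i) (\<phi> q)) 0"
      and da': "partial i (\<lambda>q. partial k (a' i) (\<phi> q)) 0 = \<mu> * partial i (partial k (a' i)) 0" for k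
    proof -
      have k: "kdiff (partial k (a' i)) (\<phi> 0)" by (rule twice_kdiffD(2)[OF ta'])
      show "kdiff (\<lambda>q. partial k (a' i) (\<phi> q)) 0"
        by (rule partial_compose(2)[OF k twice_kdiffD(1)[OF tf]])
      show "partial i (\<lambda>q. partial k (a' i) (\<phi> q)) 0 = \<mu> * partial i (partial k (a' i)) 0"
        using partial_compose(1)[OF k twice_kdiffD(1)[OF tf], of i] offdiag[of i] diag[of i] dist
        by (simp add: f_def \<phi>0 sum_cyclic[OF c])
    qed
    note kf = twice_kdiffD(2)[OF tff]
    have "\<forall>\<^sub>F q in nhds 0. partial d (F i) q = partial i (a' i) (\<phi> q) * partial d (f i) q
        + partial n (a' i) (\<phi> q) * partial d (f n) q + partial d (a' i) (\<phi> q) * partial d (f d) q"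
      using dF[of i] by eventually_elim (simp add: sum_cyclic[OF c])
    then have "partial i (partial d (F i)) 0 = partial i (\<lambda>q. partial i (a' i) (\<phi> q) * partial d (f i) q
        + partial n (a' i) (\<phi> q) * partial d (f n) q + partial d (a' i) (\<phi> q) * partial d (f d) q) 0"
      by (rule partial_cong)
    also have "\<dots> =
        partial i (a' i) (\<phi> 0) * partial i (partial d (f i)) 0 + partial d (f i) 0 * partial i (\<lambda>q. partial i (a' i) (\<phi> q)) 0
        + (partial n (a' i) (\<phi> 0) * partial i (partial d (f n)) 0 + partial d (f n) 0 * partial i (\<lambda>q. partial n (a' i) (\<phi> q)) 0)
        + (partial d (a' i) (\<phi> 0) * partial i (partial d (f d)) 0 + partial d (f d) 0 * partial i (\<lambda>q. partial d (a' i) (\<phi> q)) 0)"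
      by (simp only: partial_arith(2,3,5,6) ka' kf)
    also have "\<dots> = \<mu> * (\<mu> * partial i (partial d (a' i)) 0)"
      using dist by (simp add: \<phi>0 zero_i zero_n offdiag diag da' jets[OF c])
    finally have "\<mu> * (\<mu> * partial i (partial d (a' i)) 0) = partial n (F i) 0 * partial i (partial d (a i)) 0"
      using jF(2)[OF c, of i] by simp
    moreover have "partial n (F i) 0 = \<mu>"
      using dist by (simp add: dF0 sum_cyclic[OF c] jets[OF c] offdiag diag)
    ultimately show ?thesis using \<open>\<mu> \<noteq> 0\<close> by simp
  qed
  ultimately show ?thesis using that by (simp add: a_def a'_def)
qed

lemma invariant_preserved:
  fixes Q u v Q' u' v' :: "'a::{real_normed_field,euclidean_space} ^ 3 \<Rightarrow> 'a"
  assumes "normalized Q u v" "normalized Q' u' v'" "web_isomorphic (web Q u v) (web Q' u' v')"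
    and "inv_denom Q u v \<noteq> 0"
  shows "inv_denom Q' u' v' \<noteq> 0" "inv_numer Q' u' v' / inv_denom Q' u' v' = inv_numer Q u v / inv_denom Q u v"
proof -
  obtain \<mu> where "\<mu> \<noteq> 0"
    and \<mu>: "\<And>i n d. cyclic i n d \<Longrightarrow>
      partial i (partial d (web_fn i Q u v)) 0 = \<mu> * partial i (partial d (web_fn i Q' u' v')) 0"
    using torsion_scaling[OF assms(1-3)] by blast
  have "inv_denom Q u v = \<mu> * inv_denom Q' u' v'" "inv_numer Q u v = \<mu> * inv_numer Q' u' v'"
    using \<mu>[of 1 2 3] \<mu>[of 2 3 1] assms by (simp_all add: inv_denom_eq inv_numer_eq cyclic_def)
  then show "inv_denom Q' u' v' \<noteq> 0" "inv_numer Q' u' v' / inv_denom Q' u' v' = inv_numer Q u v / inv_denom Q u v"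
    using \<open>\<mu> \<noteq> 0\<close> assms(4) by auto
qed

section \<open>Taylor coefficients and the values of the invariant\<close>

text \<open>
  The factorials are multiplied out rather than divided, which makes the induction over a shifted
  index immediate.
\<close>

lemma funpow_dcoeff:
  "(dcoeff 1 ^^ n) c (i, j, k) * fact i = fact (i + n) * c (i + n, j, k)"
  "(dcoeff 2 ^^ n) c (i, j, k) * fact j = fact (j + n) * c (i, j + n, k)"
  "(dcoeff 3 ^^ n) c (i, j, k) * fact k = fact (k + n) * c (i, j, k + n)"
proof (induction n arbitrary: i j k)
  case (Suc n)
  { case 1 show ?case using Suc.IH(1)[of "Suc i" j k] by (simp add: algebra_simps) }
  { case 2 show ?case using Suc.IH(2)[of i "Suc j" k] by (simp add: algebra_simps) }
  { case 3 show ?case using Suc.IH(3)[of i j "Suc k"] by (simp add: algebra_simps) }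
qed simp_all

lemma power_series_partials:
  fixes F :: "'a::{real_normed_field,euclidean_space} ^ 3 \<Rightarrow> 'a"
  assumes "\<And>w. (\<forall>m. norm (w $ m) < r) \<Longrightarrow> (mterm c w has_sum F (p + w)) UNIV"
    and "\<forall>m. norm (w $ m) < r"
  shows "(mterm ((dcoeff m ^^ n) c) w has_sum (partial m ^^ n) F (p + w)) UNIV"
  using assms(2)
proof (induction n arbitrary: w)
  case 0
  then show ?case using assms(1) by simp
next
  case (Suc n)
  then show ?case using power_series_partial[OF Suc.IH] by simp
qed

lemma taylor_power_series:
  fixes F :: "'a::{real_normed_field,euclidean_space} ^ 3 \<Rightarrow> 'a"
  assumes "r > 0" and ps: "\<And>w. (\<forall>m. norm (w $ m) < r) \<Longrightarrow> (mterm c w has_sum F w) UNIV"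
  shows "taylor F i j k = c (i, j, k)"
proof -
  let ?c = "(dcoeff 1 ^^ i) ((dcoeff 2 ^^ j) ((dcoeff 3 ^^ k) c))"
  have "(mterm ?c w has_sum (partial 1 ^^ i) ((partial 2 ^^ j) ((partial 3 ^^ k) F)) (0 + w)) UNIV"
    if "\<forall>m. norm (w $ m) < r" for w
    using that by (intro power_series_partials[where r = r]) (simp_all add: ps)
  from this[of 0] have "(mterm ?c 0 has_sum (partial 1 ^^ i) ((partial 2 ^^ j) ((partial 3 ^^ k) F)) 0) UNIV"
    using \<open>r > 0\<close> by simp
  moreover have "(mterm ?c 0 has_sum mterm ?c 0 (0, 0, 0)) UNIV"
    by (rule has_sum_finite_neutralI[where B = "{(0, 0, 0)}"]) (auto simp: mterm_def power_0_left split: if_splits)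
  ultimately have "(partial 1 ^^ i) ((partial 2 ^^ j) ((partial 3 ^^ k) F)) 0 = ?c (0, 0, 0)"
    using has_sum_unique by (fastforce simp: mterm_def)
  also have "\<dots> = fact i * (fact j * (fact k * c (i, j, k)))"
    using funpow_dcoeff(1)[of i "(dcoeff 2 ^^ j) ((dcoeff 3 ^^ k) c)" 0 0 0]
      funpow_dcoeff(2)[of j "(dcoeff 3 ^^ k) c" i 0 0] funpow_dcoeff(3)[of k c i j 0]
    by simp
  finally show ?thesis by (simp add: taylor_def)
qed

lemma polynomial_taylor:
  fixes F :: "'a::{real_normed_field,euclidean_space} ^ 3 \<Rightarrow> 'a"
  assumes "finite S" "\<And>\<alpha>. \<alpha> \<notin> S \<Longrightarrow> c \<alpha> = 0" "\<And>w. F w = (\<Sum>\<alpha>\<in>S. mterm c w \<alpha>)"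
  shows "analytic3_at F 0" and "taylor F i j k = c (i, j, k)"
proof -
  have ps: "(mterm c w has_sum F w) UNIV" for w
    using assms by (intro has_sum_finite_neutralI[where B = S]) (auto simp: mterm_def split: prod.splits)
  then show "analytic3_at F 0"
    unfolding analytic3_at_iff by (intro exI[of _ c] exI[of _ "1::real"]) simp
  show "taylor F i j k = c (i, j, k)"
    by (rule taylor_power_series[of 1]) (simp_all add: ps)
qed

text \<open>
  The terms \<open>c x y\<^sup>2\<close> and \<open>x\<^sup>2 z\<close> of \<open>Q\<close> enter the numerator and the denominator separately, and
  linear \<open>u\<close>, \<open>v\<close> contribute nothing to either.
\<close>

lemma invariant_attained:
  fixes c :: "'a::{real_normed_field,euclidean_space}"
  shows "\<exists>Q u v. normalized Q u v \<and> inv_denom Q u v \<noteq> 0 \<and> inv_numer Q u v / inv_denom Q u v = c"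
proof -
  define Q u v where "Q = (\<lambda>p::'a ^ 3. (p $ 1)\<^sup>2 / 2 + p $ 2 * p $ 3 + (c * p $ 1 * (p $ 2)\<^sup>2 + (p $ 1)\<^sup>2 * p $ 3))"
    and "u = (\<lambda>p::'a ^ 3. p $ 2 - p $ 1)" and "v = (\<lambda>p::'a ^ 3. p $ 3 - p $ 1)"
  define cR where "cR = (\<lambda>\<alpha>::nat \<times> nat \<times> nat. if \<alpha> = (1, 2, 0) then c else if \<alpha> = (2, 0, 1) then 1 else 0)"
  define cQ where "cQ = (\<lambda>\<alpha>::nat \<times> nat \<times> nat. if \<alpha> = (2, 0, 0) then 1 / 2 else if \<alpha> = (0, 1, 1) then 1 else cR \<alpha>)"
  define cu where "cu = (\<lambda>\<alpha>::nat \<times> nat \<times> nat. if \<alpha> = (0, 1, 0) then 1 else if \<alpha> = (1, 0, 0) then - 1 else 0::'a)"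
  define cv where "cv = (\<lambda>\<alpha>::nat \<times> nat \<times> nat. if \<alpha> = (0, 0, 1) then 1 else if \<alpha> = (1, 0, 0) then - 1 else 0::'a)"
  have Q: "analytic3_at Q 0" "taylor Q i j k = cQ (i, j, k)" for i j k
    by (rule polynomial_taylor[of "{(2, 0, 0), (0, 1, 1), (1, 2, 0), (2, 0, 1)}" cQ Q];
      auto simp: cQ_def cR_def Q_def mterm_def)+
  have u: "analytic3_at u 0" "taylor u i j k = cu (i, j, k)" for i j k
    by (rule polynomial_taylor[of "{(0, 1, 0), (1, 0, 0)}" cu u]; auto simp: cu_def u_def mterm_def)+
  have v: "analytic3_at v 0" "taylor v i j k = cv (i, j, k)" for i j k
    by (rule polynomial_taylor[of "{(0, 0, 1), (1, 0, 0)}" cv v]; auto simp: cv_def v_def mterm_def)+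
  have R: "taylor (\<lambda>p. Q p - ((p $ 1)\<^sup>2 / 2 + p $ 2 * p $ 3)) i j k = cR (i, j, k)" for i j k
    by (rule polynomial_taylor[of "{(1, 2, 0), (2, 0, 1)}" cR]; auto simp: cR_def Q_def mterm_def)
  have 0: "taylor (\<lambda>p::'a ^ 3. 0) i j k = 0" for i j k
    by (rule polynomial_taylor[of "{}" "\<lambda>_. 0"]) auto
  have "normalized Q u v"
    unfolding normalized_def order_at_least_def
    using Q(1) u(1) v(1) by (auto simp: R u_def v_def 0 cR_def)
  moreover have "inv_denom Q u v = 2" "inv_numer Q u v = 2 * c"
    by (simp_all add: inv_denom_def inv_numer_def Q u v cQ_def cR_def cu_def cv_def)
  ultimately show ?thesis by (intro exI[of _ Q] exI[of _ u] exI[of _ v]) simp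
qed

theorem mainTheorem4:
  shows
    "((\<forall>(Q :: complex ^ 3 \<Rightarrow> complex) u v Q' u' v'.
         normalized Q u v \<and> normalized Q' u' v' \<and>
         web_isomorphic (web Q u v) (web Q' u' v') \<and> inv_denom Q u v \<noteq> 0 \<longrightarrow>
         inv_denom Q' u' v' \<noteq> 0 \<and>
         inv_numer Q' u' v' / inv_denom Q' u' v' = inv_numer Q u v / inv_denom Q u v) \<and>
      (\<forall>c :: complex. \<exists>Q u v. normalized Q u v \<and> inv_denom Q u v \<noteq> 0 \<and>
         inv_numer Q u v / inv_denom Q u v = c)) \<and>
     ((\<forall>(Q :: real ^ 3 \<Rightarrow> real) u v Q' u' v'.
         normalized Q u v \<and> normalized Q' u' v' \<and>
         web_isomorphic (web Q u v) (web Q' u' v') \<and> inv_denom Q u v \<noteq> 0 \<longrightarrow>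
         inv_denom Q' u' v' \<noteq> 0 \<and>
         inv_numer Q' u' v' / inv_denom Q' u' v' = inv_numer Q u v / inv_denom Q u v) \<and>
      (\<forall>c :: real. \<exists>Q u v. normalized Q u v \<and> inv_denom Q u v \<noteq> 0 \<and>
         inv_numer Q u v / inv_denom Q u v = c))"
  by (intro conjI allI impI; (elim conjE)?;
      (rule invariant_attained | erule (3) invariant_preserved))

end
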